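(* Let $G$ be a group. A multiplier Hopf algebra $(A,\Delta)$ is $G$-cograded if and only if there is a non-degenerate algebra embedding (injective homomorphism) $\gamma:K(G)\to M(A)$ satisfying (i) $\gamma(K(G))$ belongs to the centre $Z(M(A))$ of $M(A)$, and (ii) $\gamma$ is also a coalgebra map, that is, $\Delta(\gamma(f))=(\gamma\otimes\gamma)(\Delta_G(f))$ for all $f\in K(G)$. In the case of a $G$-cograded multiplier Hopf $^*$-algebra, $\gamma$ is a $^*$-map.
   Context: All algebras are associative algebras over $\mathbb{C}$, with or without identity, with non-degenerate product (if $ab=0$ for all $b$ then $a=0$; if $ab=0$ for all $a$ then $b=0$). $M(A)$ is the multiplier algebra of $A$ (the largest unital algebra containing $A$ as an essential two-sided ideal); if $A$ is a $^*$-algebra, so is $M(A)$. A homomorphism $\alpha:A\to M(B)$ is non-degenerate if $\alpha(A)B=B\alpha(A)=B$ (linear spans); it then extends uniquely to a unital homomorphism $M(A)\to M(B)$, denoted by the same symbol. A multiplier Hopf algebra is a pair $(A,\Delta)$, where $\Delta:A\to M(A\otimes A)$ is a homomorphism such that $\Delta(a)(1\otimes b)\in A\otimes A$ and $(a\otimes 1)\Delta(b)\in A\otimes A$ for all $a,b\in A$, such that $(a\otimes1\otimes1)(\Delta\otimes\iota)(\Delta(b)(1\otimes c))=((\iota\otimes\Delta)((a\otimes1)\Delta(b)))(1\otimes1\otimes c)$ for all $a,b,c\in A$ ($\iota$ is the identity map), and such that the linear maps $a\otimes b\mapsto\Delta(a)(1\otimes b)$ and $a\otimes b\mapsto(a\otimes1)\Delta(b)$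 are bijections of $A\otimes A$ onto itself. Then $\Delta$ is non-degenerate and extends to $M(A)\to M(A\otimes A)$. It is a multiplier Hopf $^*$-algebra if $A$ is a $^*$-algebra and $\Delta$ is a $^*$-homomorphism. $(A,\Delta)$ is $G$-cograded if there is a family of non-trivial subalgebras $(A_p)_{p\in G}$ of $A$ with $A=\bigoplus_{p\in G}A_p$, $A_pA_q=0$ whenever $p\ne q$, and $\Delta(A_{pq})(1\otimes A_q)=A_p\otimes A_q$ and $(A_p\otimes1)\Delta(A_{pq})=A_p\otimes A_q$ (linear spans) for all $p,q\in G$. For a $G$-cograded multiplier Hopf $^*$-algebra the $A_p$ are moreover required to be $^*$-subalgebras. $K(G)$ is the $^*$-algebra of complex functions with finite support on $G$, with pointwise operations and complex conjugation as involution; its coproduct $\Delta_G:K(G)\to M(K(G)\otimes K(G))$ is $(\Delta_G(f))(p,q)=f(pq)$, where $M(K(G)\otimes K(G))$ is identified with the algebra of all complex functions on $G\times G$. *)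

theory Defs
  imports Complex_Main
begin

section \<open>Complex algebras, with or without identity\<close>

class complex_vector = ab_group_add +
  fixes scaleC :: "complex \<Rightarrow> 'a \<Rightarrow> 'a" (infixr "*\<^sub>C" 75)
  assumes scaleC_add_right: "c *\<^sub>C (x + y) = c *\<^sub>C x + c *\<^sub>C y"
    and scaleC_add_left: "(c + d) *\<^sub>C x = c *\<^sub>C x + d *\<^sub>C x"
    and scaleC_scaleC: "c *\<^sub>C (d *\<^sub>C x) = (c * d) *\<^sub>C x"
    and scaleC_one: "1 *\<^sub>C x = x"

class complex_algebra = complex_vector + ring +
  assumes mult_scaleC_left: "(c *\<^sub>C x) * y = c *\<^sub>C (x * y)"
    and mult_scaleC_right: "x * (c *\<^sub>C y) = c *\<^sub>C (x * y)"

class nondegenerate_algebra = complex_algebra +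
  assumes nondegenerate_left: "(\<And>b. a * b = 0) \<Longrightarrow> a = 0"
    and nondegenerate_right: "(\<And>a. a * b = 0) \<Longrightarrow> b = 0"

global_interpretation complex_vector: vector_space "scaleC :: complex \<Rightarrow> 'a \<Rightarrow> 'a::complex_vector"
  by standard (simp_all add: scaleC_add_right scaleC_add_left scaleC_scaleC scaleC_one)

abbreviation cspan :: "'a::complex_vector set \<Rightarrow> 'a set"
  where "cspan \<equiv> module.span scaleC"

abbreviation csubspace :: "'a::complex_vector set \<Rightarrow> bool"
  where "csubspace \<equiv> module.subspace scaleC"

abbreviation clinear :: "('a::complex_vector \<Rightarrow> 'b::complex_vector) \<Rightarrow> bool"
  where "clinear \<equiv> Vector_Spaces.linear scaleC scaleC"

definition cbilinear :: "('a::complex_vector \<Rightarrow> 'b::complex_vector \<Rightarrow> 'c::complex_vector) \<Rightarrow> bool"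
  where "cbilinear f \<longleftrightarrow> (\<forall>a. clinear (f a)) \<and> (\<forall>b. clinear (\<lambda>a. f a b))"

definition algebra_hom :: "('a::complex_algebra \<Rightarrow> 'b::complex_algebra) \<Rightarrow> bool"
  where "algebra_hom f \<longleftrightarrow> clinear f \<and> (\<forall>a b. f (a * b) = f a * f b)"

definition subalgebra :: "'a::complex_algebra set \<Rightarrow> bool"
  where "subalgebra S \<longleftrightarrow> csubspace S \<and> (\<forall>a\<in>S. \<forall>b\<in>S. a * b \<in> S)"

definition centre :: "'a::complex_algebra set"
  where "centre = {z. \<forall>m. z * m = m * z}"

definition star_algebra :: "('a::complex_algebra \<Rightarrow> 'a) \<Rightarrow> bool"
  where "star_algebra star \<longleftrightarrow>
    (\<forall>a b. star (a + b) = star a + star b) \<and>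
    (\<forall>c a. star (c *\<^sub>C a) = cnj c *\<^sub>C star a) \<and>
    (\<forall>a b. star (a * b) = star b * star a) \<and>
    (\<forall>a. star (star a) = a)"

lemma clinearI:
  assumes "\<And>x y. f (x + y) = f x + f y" "\<And>c x. f (c *\<^sub>C x) = c *\<^sub>C f x"
  shows "clinear f"
  by unfold_locales (simp_all add: assms scaleC_add_right scaleC_add_left scaleC_scaleC scaleC_one)

lemma clinear_add: "clinear f \<Longrightarrow> f (x + y) = f x + f y"
  by (rule module_hom.add[OF Vector_Spaces.linear.axioms(3)])

lemma clinear_scaleC: "clinear f \<Longrightarrow> f (c *\<^sub>C x) = c *\<^sub>C f x"
  by (rule module_hom.scale[OF Vector_Spaces.linear.axioms(3)])

lemma scaleC_zero_left [simp]: "0 *\<^sub>C (x::'a::complex_vector) = 0"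
  by (rule complex_vector.scale_zero_left)

lemma scaleC_zero_right [simp]: "c *\<^sub>C (0::'a::complex_vector) = 0"
  by (rule complex_vector.scale_zero_right)

lemma clinear_0: "clinear f \<Longrightarrow> f 0 = 0"
  using clinear_scaleC[of f 0 0] by simp

lemma clinear_diff: "clinear f \<Longrightarrow> f (x - y) = f x - f y"
  using clinear_add[of f "x - y" y] by (simp add: algebra_simps)

lemma clinear_uminus: "clinear f \<Longrightarrow> f (- x) = - f x"
  using clinear_diff[of f 0 x] by (simp add: clinear_0)

lemma clinear_comp: "clinear f \<Longrightarrow> clinear g \<Longrightarrow> clinear (\<lambda>x. f (g x))"
  by (rule clinearI) (simp_all only: clinear_add[of f] clinear_scaleC[of f] clinear_add[of g] clinear_scaleC[of g])

lemma clinear_simps: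
  assumes "clinear f"
  shows "f (x + y) = f x + f y" "f (x - y) = f x - f y" "f (- x) = - f x" "f 0 = 0"
    "f (c *\<^sub>C x) = c *\<^sub>C f x"
  by (rule clinear_add clinear_diff clinear_uminus clinear_0 clinear_scaleC, rule assms)+

lemma clinear_id: "clinear (\<lambda>x. x)"
  by (rule clinearI) simp_all

lemma cbilinearD:
  assumes "cbilinear f"
  shows "clinear (f a)" "clinear (\<lambda>a. f a b)"
  using assms by (auto simp: cbilinear_def)

lemma cbilinear_simps:
  assumes "cbilinear f"
  shows "f (x + y) b = f x b + f y b" "f a (u + v) = f a u + f a v"
    "f (c *\<^sub>C x) b = c *\<^sub>C f x b" "f a (c *\<^sub>C u) = c *\<^sub>C f a u"
  using clinear_add[OF cbilinearD(2)[OF assms]] clinear_add[OF cbilinearD(1)[OF assms]]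
    clinear_scaleC[OF cbilinearD(2)[OF assms]] clinear_scaleC[OF cbilinearD(1)[OF assms]]
  by simp_all


section \<open>Finitely supported functions\<close>

text \<open>This type is both the algebra \<open>K(G)\<close>, with pointwise operations, and
  the free vector space on its index type.\<close>

typedef 'k finsupp = "{f :: 'k \<Rightarrow> complex. finite {k. f k \<noteq> 0}}"
  morphisms fun_of Abs_finsupp
  by (rule exI[of _ "\<lambda>_. 0"]) simp

setup_lifting type_definition_finsupp

instantiation finsupp :: (type) complex_algebra
begin

lift_definition zero_finsupp :: "'a finsupp" is "\<lambda>_. 0" by simp

lift_definition plus_finsupp :: "'a finsupp \<Rightarrow> 'a finsupp \<Rightarrow> 'a finsupp"
  is "\<lambda>f g k. f k + g k"
  subgoal for f g by (rule finite_subset[of _ "{k. f k \<noteq> 0} \<union> {k. g k \<noteq> 0}"]) auto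
  done

lift_definition minus_finsupp :: "'a finsupp \<Rightarrow> 'a finsupp \<Rightarrow> 'a finsupp"
  is "\<lambda>f g k. f k - g k"
  subgoal for f g by (rule finite_subset[of _ "{k. f k \<noteq> 0} \<union> {k. g k \<noteq> 0}"]) auto
  done

lift_definition uminus_finsupp :: "'a finsupp \<Rightarrow> 'a finsupp"
  is "\<lambda>f k. - f k" by simp

lift_definition times_finsupp :: "'a finsupp \<Rightarrow> 'a finsupp \<Rightarrow> 'a finsupp"
  is "\<lambda>f g k. f k * g k"
  subgoal for f g by (rule finite_subset[of _ "{k. f k \<noteq> 0}"]) auto
  done

lift_definition scaleC_finsupp :: "complex \<Rightarrow> 'a finsupp \<Rightarrow> 'a finsupp"
  is "\<lambda>c f k. c * f k"
  subgoal for c f by (rule finite_subset[of _ "{k. f k \<noteq> 0}"]) auto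
  done

instance
  by standard (transfer; simp add: algebra_simps fun_eq_iff)+

end

lift_definition delta :: "'k \<Rightarrow> 'k finsupp"
  is "\<lambda>k j. if j = k then 1 else 0" by simp

lift_definition finsupp_cnj :: "'k finsupp \<Rightarrow> 'k finsupp"
  is "\<lambda>f k. cnj (f k)" by simp

definition finsupp_lift :: "('k \<Rightarrow> 'v::complex_vector) \<Rightarrow> 'k finsupp \<Rightarrow> 'v"
  where "finsupp_lift f x = (\<Sum>k | fun_of x k \<noteq> 0. fun_of x k *\<^sub>C f k)"

lemma finite_supp: "finite {k. fun_of x k \<noteq> 0}"
  using fun_of by auto

lemma finsupp_lift_superset:
  assumes "finite S" "{k. fun_of x k \<noteq> 0} \<subseteq> S"
  shows "finsupp_lift f x = (\<Sum>k\<in>S. fun_of x k *\<^sub>C f k)"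
  unfolding finsupp_lift_def by (rule sum.mono_neutral_left) (use assms in auto)

lemma clinear_finsupp_lift: "clinear (finsupp_lift f)"
proof (rule clinearI)
  fix x y :: "'a finsupp"
  let ?S = "{k. fun_of x k \<noteq> 0} \<union> {k. fun_of y k \<noteq> 0}"
  have "finsupp_lift f (x + y) = (\<Sum>k\<in>?S. fun_of (x + y) k *\<^sub>C f k)"
    by (rule finsupp_lift_superset) (auto simp: finite_supp plus_finsupp.rep_eq)
  moreover have "finsupp_lift f x = (\<Sum>k\<in>?S. fun_of x k *\<^sub>C f k)"
    "finsupp_lift f y = (\<Sum>k\<in>?S. fun_of y k *\<^sub>C f k)"
    by (rule finsupp_lift_superset; auto simp: finite_supp)+
  ultimately show "finsupp_lift f (x + y) = finsupp_lift f x + finsupp_lift f y"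
    by (simp add: plus_finsupp.rep_eq scaleC_add_left sum.distrib)
next
  fix c and x :: "'a finsupp"
  have "finsupp_lift f (c *\<^sub>C x) = (\<Sum>k | fun_of x k \<noteq> 0. fun_of (c *\<^sub>C x) k *\<^sub>C f k)"
    by (rule finsupp_lift_superset) (auto simp: finite_supp scaleC_finsupp.rep_eq)
  then show "finsupp_lift f (c *\<^sub>C x) = c *\<^sub>C finsupp_lift f x"
    by (simp add: finsupp_lift_def scaleC_finsupp.rep_eq complex_vector.scale_sum_right scaleC_scaleC)
qed

lemma finsupp_lift_delta [simp]: "finsupp_lift f (delta k) = f k"
  by (subst finsupp_lift_superset[of "{k}"]) (auto simp: delta.rep_eq scaleC_one)

lemma finsupp_lift_add_fun:
  "finsupp_lift (\<lambda>k. f k + g k) x = finsupp_lift f x + finsupp_lift g x"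
  by (simp add: finsupp_lift_def scaleC_add_right sum.distrib)

lemma finsupp_lift_scaleC_fun:
  "finsupp_lift (\<lambda>k. c *\<^sub>C f k) x = c *\<^sub>C finsupp_lift f x"
  by (simp add: finsupp_lift_def complex_vector.scale_sum_right scaleC_scaleC mult.commute)

lemma finsupp_lift_delta_id: "finsupp_lift delta x = x"
proof -
  have sum_rep: "fun_of (sum h S) j = (\<Sum>k\<in>S. fun_of (h k) j)" if "finite S"
    for h :: "'a \<Rightarrow> 'a finsupp" and S j
    using that by induction (simp_all add: zero_finsupp.rep_eq plus_finsupp.rep_eq)
  have "fun_of (finsupp_lift delta x) j = fun_of x j" for j
    unfolding finsupp_lift_def
    by (simp add: sum_rep finite_supp scaleC_finsupp.rep_eq delta.rep_eq if_distrib[of "\<lambda>z. _ * z"]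
        sum.delta cong: if_cong)
  then show ?thesis
    by (metis fun_of_inject ext)
qed

lemma finsupp_induct [case_names zero add scale delta]:
  assumes "P 0" "\<And>x y. P x \<Longrightarrow> P y \<Longrightarrow> P (x + y)" "\<And>c x. P x \<Longrightarrow> P (c *\<^sub>C x)" "\<And>k. P (delta k)"
  shows "P (x::'k finsupp)"
proof -
  have "P (\<Sum>k\<in>S. fun_of x k *\<^sub>C delta k)" if "finite S" for S
    using that by induction (auto intro: assms)
  from this[OF finite_supp[of x]] show ?thesis
    using finsupp_lift_delta_id[of x] by (simp add: finsupp_lift_def)
qed

lemma clinear_finsupp_eqI:
  assumes "clinear f" "clinear g" "\<And>k. f (delta k) = g (delta k)"
  shows "f x = g x"
  by (induction x rule: finsupp_induct)
    (simp_all add: assms(3) clinear_simps[OF assms(1)] clinear_simps[OF assms(2)])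

lemma finsupp_cnj_simps [simp]:
  "finsupp_cnj (x + y) = finsupp_cnj x + finsupp_cnj y"
  "finsupp_cnj (x - y) = finsupp_cnj x - finsupp_cnj y"
  "finsupp_cnj (c *\<^sub>C x) = cnj c *\<^sub>C finsupp_cnj x"
  "finsupp_cnj 0 = 0"
  "finsupp_cnj (delta k) = delta k"
  by (transfer; auto)+


section \<open>Tensor products\<close>

definition tensor_null :: "('a::complex_vector \<times> 'b::complex_vector) finsupp set"
  where "tensor_null = cspan (
    {delta (a + a', b) - delta (a, b) - delta (a', b) | a a' b. True} \<union>
    {delta (a, b + b') - delta (a, b) - delta (a, b') | a b b'. True} \<union>
    {delta (c *\<^sub>C a, b) - c *\<^sub>C delta (a, b) | c a b. True} \<union>
    {delta (a, c *\<^sub>C b) - c *\<^sub>C delta (a, b) | c a b. True})"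

lemma subspace_tensor_null: "csubspace tensor_null"
  unfolding tensor_null_def by (rule complex_vector.subspace_span)

lemmas tensor_null_closed =
  complex_vector.subspace_0[OF subspace_tensor_null]
  complex_vector.subspace_add[OF subspace_tensor_null]
  complex_vector.subspace_diff[OF subspace_tensor_null]
  complex_vector.subspace_neg[OF subspace_tensor_null]
  complex_vector.subspace_scale[OF subspace_tensor_null]

lemma tensor_null_base:
  "delta (a + a', b) - delta (a, b) - delta (a', b) \<in> tensor_null"
  "delta (a, b + b') - delta (a, b) - delta (a, b') \<in> tensor_null"
  "delta (c *\<^sub>C a, b) - c *\<^sub>C delta (a, b) \<in> tensor_null"
  "delta (a, c *\<^sub>C b) - c *\<^sub>C delta (a, b) \<in> tensor_null"
  unfolding tensor_null_def by (rule complex_vector.span_base; blast)+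

quotient_type (overloaded) ('a, 'b) tensor =
  "('a::complex_vector \<times> 'b::complex_vector) finsupp" / "\<lambda>x y. x - y \<in> tensor_null"
proof (rule equivpI)
  show "reflp (\<lambda>x y::('a \<times> 'b) finsupp. x - y \<in> tensor_null)"
    by (simp add: reflp_def tensor_null_closed)
  show "symp (\<lambda>x y::('a \<times> 'b) finsupp. x - y \<in> tensor_null)"
    by (rule sympI) (metis minus_diff_eq tensor_null_closed(4))
  show "transp (\<lambda>x y::('a \<times> 'b) finsupp. x - y \<in> tensor_null)"
  proof (rule transpI)
    fix x y z :: "('a \<times> 'b) finsupp"
    assume "x - y \<in> tensor_null" "y - z \<in> tensor_null"
    then have "(x - y) + (y - z) \<in> tensor_null" by (rule tensor_null_closed)
    then show "x - z \<in> tensor_null" by simp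
  qed
qed

type_notation tensor (infixr "\<otimes>" 72)

instantiation tensor :: (complex_vector, complex_vector) complex_vector
begin

lift_definition zero_tensor :: "'a \<otimes> 'b" is 0 .

lift_definition plus_tensor :: "'a \<otimes> 'b \<Rightarrow> 'a \<otimes> 'b \<Rightarrow> 'a \<otimes> 'b" is "(+)"
  by (simp add: add_diff_add tensor_null_closed)

lift_definition minus_tensor :: "'a \<otimes> 'b \<Rightarrow> 'a \<otimes> 'b \<Rightarrow> 'a \<otimes> 'b" is "(-)"
proof -
  fix x y u v :: "('a \<times> 'b) finsupp"
  assume "x - y \<in> tensor_null" "u - v \<in> tensor_null"
  then have "(x - y) - (u - v) \<in> tensor_null" by (rule tensor_null_closed)
  then show "x - u - (y - v) \<in> tensor_null" by (simp add: algebra_simps)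
qed

lift_definition uminus_tensor :: "'a \<otimes> 'b \<Rightarrow> 'a \<otimes> 'b" is uminus
proof -
  fix x y :: "('a \<times> 'b) finsupp"
  assume "x - y \<in> tensor_null"
  then have "- (x - y) \<in> tensor_null" by (rule tensor_null_closed)
  then show "- x - - y \<in> tensor_null" by (simp add: algebra_simps)
qed

lift_definition scaleC_tensor :: "complex \<Rightarrow> 'a \<otimes> 'b \<Rightarrow> 'a \<otimes> 'b" is "(*\<^sub>C)"
  by (metis complex_vector.scale_right_diff_distrib tensor_null_closed(5))

instance
proof
  fix x y z :: "'a \<otimes> 'b" and c d :: complex
  show "x + y + z = x + (y + z)" by transfer (simp add: add.assoc tensor_null_closed)
  show "x + y = y + x" by transfer (simp add: add.commute tensor_null_closed)
  show "0 + x = x" by transfer (simp add: tensor_null_closed)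
  show "- x + x = 0" by transfer (simp add: tensor_null_closed)
  show "x - y = x + - y" by transfer (simp add: tensor_null_closed)
  show "c *\<^sub>C (x + y) = c *\<^sub>C x + c *\<^sub>C y"
    by (induction x rule: tensor.abs_induct, induction y rule: tensor.abs_induct)
      (simp only: plus_tensor.abs_eq scaleC_tensor.abs_eq scaleC_add_right)
  show "(c + d) *\<^sub>C x = c *\<^sub>C x + d *\<^sub>C x"
    by (induction x rule: tensor.abs_induct)
      (simp only: plus_tensor.abs_eq scaleC_tensor.abs_eq scaleC_add_left)
  show "c *\<^sub>C (d *\<^sub>C x) = (c * d) *\<^sub>C x"
    by (induction x rule: tensor.abs_induct) (simp only: scaleC_tensor.abs_eq scaleC_scaleC)
  show "1 *\<^sub>C x = x"
    by (induction x rule: tensor.abs_induct) (simp only: scaleC_tensor.abs_eq scaleC_one)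
qed

end

lift_definition tensor_of :: "'a::complex_vector \<Rightarrow> 'b::complex_vector \<Rightarrow> 'a \<otimes> 'b" (infixr "\<otimes>" 72)
  is "\<lambda>a b. delta (a, b)" .

text \<open>The linear map induced by a bilinear map; it depends on the chosen
  representative if \<open>f\<close> is not bilinear.\<close>

definition tensor_lift ::
    "('a::complex_vector \<Rightarrow> 'b::complex_vector \<Rightarrow> 'c::complex_vector) \<Rightarrow> 'a \<otimes> 'b \<Rightarrow> 'c"
  where "tensor_lift f t = finsupp_lift (case_prod f) (rep_tensor t)"

lemma cbilinear_tensor_of: "cbilinear (\<otimes>)"
  unfolding cbilinear_def
proof (intro conjI allI clinearI)
  fix a a' :: 'a and b b' :: 'b and c
  show "a \<otimes> (b + b') = a \<otimes> b + a \<otimes> b'"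
    unfolding tensor_of.abs_eq plus_tensor.abs_eq tensor.abs_eq_iff
    using tensor_null_base by (simp only: diff_diff_eq)
  show "(a + a') \<otimes> b = a \<otimes> b + a' \<otimes> b"
    unfolding tensor_of.abs_eq plus_tensor.abs_eq tensor.abs_eq_iff
    using tensor_null_base by (simp only: diff_diff_eq)
  show "a \<otimes> (c *\<^sub>C b) = c *\<^sub>C (a \<otimes> b)"
    unfolding tensor_of.abs_eq scaleC_tensor.abs_eq tensor.abs_eq_iff
    by (rule tensor_null_base)
  show "(c *\<^sub>C a) \<otimes> b = c *\<^sub>C (a \<otimes> b)"
    unfolding tensor_of.abs_eq scaleC_tensor.abs_eq tensor.abs_eq_iff
    by (rule tensor_null_base)
qed

lemma tensor_of_add_left: "(a + a') \<otimes> b = a \<otimes> b + a' \<otimes> b"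
  and tensor_of_add_right: "a \<otimes> (b + b') = a \<otimes> b + a \<otimes> b'"
  and tensor_of_scaleC_left: "(c *\<^sub>C a) \<otimes> b = c *\<^sub>C (a \<otimes> b)"
  and tensor_of_scaleC_right: "a \<otimes> (c *\<^sub>C b) = c *\<^sub>C (a \<otimes> b)"
  by (rule cbilinear_simps[OF cbilinear_tensor_of])+

lemma tensor_null_lift:
  assumes "cbilinear f" "x \<in> tensor_null"
  shows "finsupp_lift (case_prod f) x = 0"
  using assms(2) unfolding tensor_null_def
proof (induction rule: complex_vector.span_induct)
  case base
  show ?case
    by (auto simp: complex_vector.subspace_def clinear_simps[OF clinear_finsupp_lift])
next
  case (step x)
  then show ?case
    by (auto simp: cbilinear_simps[OF assms(1)] clinear_simps[OF clinear_finsupp_lift])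
qed

lemma tensor_lift_abs:
  assumes "cbilinear f"
  shows "tensor_lift f (abs_tensor x) = finsupp_lift (case_prod f) x"
proof -
  have "rep_tensor (abs_tensor x) - x \<in> tensor_null"
    by (rule Quotient3_rep_abs[OF Quotient3_tensor]) (simp add: tensor_null_closed)
  from tensor_null_lift[OF assms this] show ?thesis
    by (simp add: tensor_lift_def clinear_simps[OF clinear_finsupp_lift])
qed

lemma tensor_lift_of: "cbilinear f \<Longrightarrow> tensor_lift f (a \<otimes> b) = f a b"
  by (simp add: tensor_of.abs_eq tensor_lift_abs)

lemma clinear_tensor_lift:
  assumes "cbilinear f"
  shows "clinear (tensor_lift f)"
proof (rule clinearI)
  show "tensor_lift f (x + y) = tensor_lift f x + tensor_lift f y" for x y
    by (induction x rule: tensor.abs_induct, induction y rule: tensor.abs_induct)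
      (simp add: plus_tensor.abs_eq tensor_lift_abs assms clinear_simps[OF clinear_finsupp_lift])
  show "tensor_lift f (c *\<^sub>C x) = c *\<^sub>C tensor_lift f x" for c x
    by (induction x rule: tensor.abs_induct)
      (simp add: scaleC_tensor.abs_eq tensor_lift_abs assms clinear_simps[OF clinear_finsupp_lift])
qed

lemma tensor_lift_add_fun:
  "tensor_lift (\<lambda>a b. f a b + g a b) t = tensor_lift f t + tensor_lift g t"
  by (simp add: tensor_lift_def case_prod_unfold finsupp_lift_add_fun)

lemma tensor_lift_scaleC_fun:
  "tensor_lift (\<lambda>a b. c *\<^sub>C f a b) t = c *\<^sub>C tensor_lift f t"
  by (simp add: tensor_lift_def case_prod_unfold finsupp_lift_scaleC_fun)

lemma tensor_induct [case_names add of]: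
  assumes "\<And>x y. P x \<Longrightarrow> P y \<Longrightarrow> P (x + y)" "\<And>a b. P (a \<otimes> b)"
  shows "P t"
proof (induction t rule: tensor.abs_induct)
  fix y :: "('a \<times> 'b) finsupp"
  have "\<forall>c. P (c *\<^sub>C abs_tensor y)"
  proof (induction y rule: finsupp_induct)
    case zero
    have "abs_tensor 0 = (0::'a \<otimes> 'b)" by (rule zero_tensor.abs_eq[symmetric])
    moreover have "(0::'a) \<otimes> (0::'b) = 0"
      using tensor_of_scaleC_left[of 0 "0::'a" "0::'b"] by simp
    ultimately show ?case using assms(2)[of 0 0] by simp
  next
    case (add x y)
    then show ?case
      unfolding plus_tensor.abs_eq[symmetric] scaleC_add_right by (blast intro: assms(1))
  next
    case (scale c x)
    then show ?case unfolding scaleC_tensor.abs_eq[symmetric] scaleC_scaleC by blast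
  next
    case (delta k)
    then show ?case
      by (cases k) (simp only: assms(2) tensor_of.abs_eq[symmetric] tensor_of_scaleC_left[symmetric] simp_thms)
  qed
  from this[rule_format, of 1] show "P (abs_tensor y)" by (simp add: scaleC_one)
qed

lemma clinear_tensor_eqI:
  assumes "clinear f" "clinear g" "\<And>a b. f (a \<otimes> b) = g (a \<otimes> b)"
  shows "f t = g t"
  by (induction t rule: tensor_induct) (simp_all add: assms(3) clinear_simps[OF assms(1)] clinear_simps[OF assms(2)])

lemma tensor_universal:
  assumes "cbilinear f"
  shows "\<exists>!g. clinear g \<and> (\<forall>a b. g (a \<otimes> b) = f a b)"
proof (rule ex1I[of _ "tensor_lift f"])
  show "clinear (tensor_lift f) \<and> (\<forall>a b. tensor_lift f (a \<otimes> b) = f a b)"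
    by (simp add: assms clinear_tensor_lift tensor_lift_of)
  show "g = tensor_lift f" if "clinear g \<and> (\<forall>a b. g (a \<otimes> b) = f a b)" for g
    by (rule ext, rule clinear_tensor_eqI) (simp_all add: that assms clinear_tensor_lift tensor_lift_of)
qed

instantiation tensor :: (complex_algebra, complex_algebra) complex_algebra
begin

definition times_tensor :: "'a \<otimes> 'b \<Rightarrow> 'a \<otimes> 'b \<Rightarrow> 'a \<otimes> 'b"
  where "s * t = tensor_lift (\<lambda>a b. tensor_lift (\<lambda>a' b'. (a * a') \<otimes> (b * b')) t) s"

lemma bilinear_mult_inner: "cbilinear (\<lambda>a' b'. ((a::'a) * a') \<otimes> ((b::'b) * b'))"
  unfolding cbilinear_def
  by (auto intro!: clinearI simp: distrib_left mult_scaleC_right tensor_of_add_left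
      tensor_of_add_right tensor_of_scaleC_left tensor_of_scaleC_right)

lemma bilinear_mult_outer:
  "cbilinear (\<lambda>a b. tensor_lift (\<lambda>a' b'. ((a::'a) * a') \<otimes> ((b::'b) * b')) t)"
  unfolding cbilinear_def
  by (auto intro!: clinearI simp: distrib_right mult_scaleC_left tensor_of_add_left
      tensor_of_add_right tensor_of_scaleC_left tensor_of_scaleC_right
      tensor_lift_add_fun tensor_lift_scaleC_fun)

lemma tensor_mult_of: "((a::'a) \<otimes> (b::'b)) * (a' \<otimes> b') = (a * a') \<otimes> (b * b')"
  unfolding times_tensor_def
  by (subst tensor_lift_of[OF bilinear_mult_outer], rule tensor_lift_of[OF bilinear_mult_inner])

lemma clinear_mult_tensor_left: "clinear (\<lambda>s :: 'a \<otimes> 'b. s * t)"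
  unfolding times_tensor_def by (rule clinear_tensor_lift[OF bilinear_mult_outer])

lemma clinear_mult_tensor_right: "clinear (\<lambda>t :: 'a \<otimes> 'b. s * t)"
  unfolding times_tensor_def
  by (rule clinearI)
    (simp_all add: clinear_simps[OF clinear_tensor_lift[OF bilinear_mult_inner]]
      tensor_lift_add_fun tensor_lift_scaleC_fun)

instance
proof
  fix x y z :: "'a \<otimes> 'b" and c :: complex
  show l: "(x + y) * z = x * z + y * z" for x y z :: "'a \<otimes> 'b"
    by (rule clinear_add[OF clinear_mult_tensor_left])
  show r: "x * (y + z) = x * y + x * z" for x y z :: "'a \<otimes> 'b"
    by (rule clinear_add[OF clinear_mult_tensor_right])
  show "(c *\<^sub>C x) * y = c *\<^sub>C (x * y)"
    by (rule clinear_scaleC[OF clinear_mult_tensor_left])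
  show "x * (c *\<^sub>C y) = c *\<^sub>C (x * y)"
    by (rule clinear_scaleC[OF clinear_mult_tensor_right])
  show "x * y * z = x * (y * z)"
  proof (induction x rule: tensor_induct)
    case (of a b)
    show ?case
    proof (induction y rule: tensor_induct)
      case (of a' b')
      show ?case
        by (induction z rule: tensor_induct) (simp_all add: l r tensor_mult_of mult.assoc)
    qed (simp add: l r)
  qed (simp add: l)
qed

end

definition tensor_assoc ::
    "('a::complex_vector \<otimes> 'b::complex_vector) \<otimes> 'c::complex_vector \<Rightarrow> 'a \<otimes> ('b \<otimes> 'c)"
  where "tensor_assoc = tensor_lift (\<lambda>t c. tensor_lift (\<lambda>a b. a \<otimes> (b \<otimes> c)) t)"

definition tensor_assoc_inv ::
    "'a::complex_vector \<otimes> ('b::complex_vector \<otimes> 'c::complex_vector) \<Rightarrow> ('a \<otimes> 'b) \<otimes> 'c"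
  where "tensor_assoc_inv = tensor_lift (\<lambda>a t. tensor_lift (\<lambda>b c. (a \<otimes> b) \<otimes> c) t)"

lemma bilinear_assoc1: "cbilinear (\<lambda>a b. a \<otimes> (b \<otimes> c))"
  and bilinear_assoc_inv1: "cbilinear (\<lambda>b c. (a \<otimes> b) \<otimes> c)"
  unfolding cbilinear_def
  by (auto intro!: clinearI simp: tensor_of_add_left
      tensor_of_add_right tensor_of_scaleC_left tensor_of_scaleC_right)

lemma tensor_of_fun:
  "(\<otimes>) (a + a') = (\<lambda>b. a \<otimes> b + a' \<otimes> b)"
  "(\<otimes>) (c *\<^sub>C a) = (\<lambda>b. c *\<^sub>C (a \<otimes> b))"
  by (simp_all add: fun_eq_iff tensor_of_add_left tensor_of_scaleC_left)

lemma bilinear_assoc2: "cbilinear (\<lambda>t c. tensor_lift (\<lambda>a b. a \<otimes> (b \<otimes> c)) t)"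
  and bilinear_assoc_inv2: "cbilinear (\<lambda>a t. tensor_lift (\<lambda>b c. (a \<otimes> b) \<otimes> c) t)"
  unfolding cbilinear_def
  by (auto intro!: clinearI simp: tensor_of_add_left
      tensor_of_add_right tensor_of_scaleC_left tensor_of_scaleC_right
      tensor_lift_add_fun tensor_lift_scaleC_fun
      tensor_of_fun clinear_add[OF clinear_tensor_lift[OF bilinear_assoc1]]
      clinear_add[OF clinear_tensor_lift[OF bilinear_assoc_inv1]]
      clinear_scaleC[OF clinear_tensor_lift[OF bilinear_assoc1]]
      clinear_scaleC[OF clinear_tensor_lift[OF bilinear_assoc_inv1]])

lemma tensor_assoc_of [simp]: "tensor_assoc ((a \<otimes> b) \<otimes> c) = a \<otimes> (b \<otimes> c)"
  by (simp add: tensor_assoc_def tensor_lift_of bilinear_assoc1 bilinear_assoc2)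

lemma tensor_assoc_inv_of [simp]: "tensor_assoc_inv (a \<otimes> (b \<otimes> c)) = (a \<otimes> b) \<otimes> c"
  by (simp add: tensor_assoc_inv_def tensor_lift_of bilinear_assoc_inv1 bilinear_assoc_inv2)

lemma clinear_tensor_assoc: "clinear tensor_assoc"
  and clinear_tensor_assoc_inv: "clinear tensor_assoc_inv"
  unfolding tensor_assoc_def tensor_assoc_inv_def
  by (rule clinear_tensor_lift[OF bilinear_assoc2] clinear_tensor_lift[OF bilinear_assoc_inv2])+

lemma tensor_assoc_inverse [simp]: "tensor_assoc_inv (tensor_assoc t) = t"
proof (induction t rule: tensor_induct)
  case (of s c)
  show ?case
    by (induction s rule: tensor_induct)
      (simp_all add: tensor_of_add_left clinear_add[OF clinear_tensor_assoc]
        clinear_add[OF clinear_tensor_assoc_inv])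
qed (simp add: clinear_add[OF clinear_tensor_assoc] clinear_add[OF clinear_tensor_assoc_inv])

lemma tensor_assoc_inv_inverse [simp]: "tensor_assoc (tensor_assoc_inv t) = t"
proof (induction t rule: tensor_induct)
  case (of a s)
  show ?case
    by (induction s rule: tensor_induct)
      (simp_all add: tensor_of_add_right clinear_add[OF clinear_tensor_assoc]
        clinear_add[OF clinear_tensor_assoc_inv])
qed (simp add: clinear_add[OF clinear_tensor_assoc] clinear_add[OF clinear_tensor_assoc_inv])

lemma tensor_assoc_mult:
  "tensor_assoc (s * t) = tensor_assoc s * tensor_assoc (t :: ('a::complex_algebra \<otimes> 'b::complex_algebra) \<otimes> 'c::complex_algebra)"
proof (induction s rule: tensor_induct)
  case (of s1 c)
  show ?case
  proof (induction s1 rule: tensor_induct)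
    case (of a b)
    show ?case
    proof (induction t rule: tensor_induct)
      case (of t1 d)
      show ?case
        by (induction t1 rule: tensor_induct)
          (simp_all add: tensor_of_add_left distrib_left tensor_mult_of clinear_add[OF clinear_tensor_assoc])
    qed (simp add: distrib_left clinear_add[OF clinear_tensor_assoc])
  qed (simp add: tensor_of_add_left distrib_right clinear_add[OF clinear_tensor_assoc])
qed (simp add: distrib_right clinear_add[OF clinear_tensor_assoc])

lemma tensor_assoc_inv_mult:
  "tensor_assoc_inv (s * t) = tensor_assoc_inv s *
     tensor_assoc_inv (t :: 'a::complex_algebra \<otimes> 'b::complex_algebra \<otimes> 'c::complex_algebra)"
  by (metis tensor_assoc_mult tensor_assoc_inverse tensor_assoc_inv_inverse)

text \<open>The antilinear map \<open>a \<otimes> b \<mapsto> s1 a \<otimes> s2 b\<close> for antilinear \<open>s1\<close> and \<open>s2\<close>.\<close>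

definition tensor_star ::
    "('a::complex_vector \<Rightarrow> 'a) \<Rightarrow> ('b::complex_vector \<Rightarrow> 'b) \<Rightarrow> 'a \<otimes> 'b \<Rightarrow> 'a \<otimes> 'b"
  where "tensor_star s1 s2 t = finsupp_lift (\<lambda>(a, b). s1 a \<otimes> s2 b) (finsupp_cnj (rep_tensor t))"

lemma tensor_star_of:
  assumes add1: "\<And>x y. s1 (x + y) = s1 x + s1 y" and scale1: "\<And>c x. s1 (c *\<^sub>C x) = cnj c *\<^sub>C s1 x"
    and add2: "\<And>x y. s2 (x + y) = s2 x + s2 y" and scale2: "\<And>c x. s2 (c *\<^sub>C x) = cnj c *\<^sub>C s2 x"
  shows "tensor_star s1 s2 (a \<otimes> b) = s1 a \<otimes> s2 b"
    and "tensor_star s1 s2 (s + t) = tensor_star s1 s2 s + tensor_star s1 s2 t"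
    and "tensor_star s1 s2 (c *\<^sub>C t) = cnj c *\<^sub>C tensor_star s1 s2 t"
proof -
  let ?f = "\<lambda>x. finsupp_lift (\<lambda>(a, b). s1 a \<otimes> s2 b) (finsupp_cnj x)"
  have f: "?f (x + y) = ?f x + ?f y" "?f (x - y) = ?f x - ?f y" "?f (c *\<^sub>C x) = cnj c *\<^sub>C ?f x"
    "?f 0 = 0" for x y c
    by (simp_all add: clinear_simps[OF clinear_finsupp_lift])
  have null: "?f x = 0" if "x \<in> tensor_null" for x
    using that unfolding tensor_null_def
  proof (induction rule: complex_vector.span_induct)
    case base
    show ?case by (auto simp: complex_vector.subspace_def f simp del: finsupp_cnj_simps)
  next
    case (step x)
    then show ?case
      by (auto simp: clinear_simps[OF clinear_finsupp_lift] add1 add2 scale1 scale2 tensor_of_add_left tensor_of_add_right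
          tensor_of_scaleC_left tensor_of_scaleC_right)
  qed
  have abs: "tensor_star s1 s2 (abs_tensor x) = ?f x" for x
  proof -
    have "rep_tensor (abs_tensor x) - x \<in> tensor_null"
      by (rule Quotient3_rep_abs[OF Quotient3_tensor]) (simp add: tensor_null_closed)
    from null[OF this] show ?thesis by (simp add: tensor_star_def f del: finsupp_cnj_simps)
  qed
  show "tensor_star s1 s2 (a \<otimes> b) = s1 a \<otimes> s2 b"
    by (simp add: tensor_of.abs_eq[of a b] abs)
  show "tensor_star s1 s2 (s + t) = tensor_star s1 s2 s + tensor_star s1 s2 t"
    by (induction s rule: tensor.abs_induct, induction t rule: tensor.abs_induct)
      (simp only: plus_tensor.abs_eq abs f)
  show "tensor_star s1 s2 (c *\<^sub>C t) = cnj c *\<^sub>C tensor_star s1 s2 t"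
    by (induction t rule: tensor.abs_induct) (simp only: scaleC_tensor.abs_eq abs f)
qed

lemma star_algebra_tensor:
  assumes "star_algebra s1" "star_algebra s2"
  shows "star_algebra (tensor_star s1 s2)"
proof -
  note simps = assms[unfolded star_algebra_def]
  have t: "tensor_star s1 s2 (a \<otimes> b) = s1 a \<otimes> s2 b"
    "tensor_star s1 s2 (s + t) = tensor_star s1 s2 s + tensor_star s1 s2 t"
    "tensor_star s1 s2 (c *\<^sub>C t) = cnj c *\<^sub>C tensor_star s1 s2 t" for a b s t c
    using tensor_star_of[of s1 s2] simps by blast+
  have "tensor_star s1 s2 (x * y) = tensor_star s1 s2 y * tensor_star s1 s2 x" for x y
  proof (induction x rule: tensor_induct)
    case (of a b)
    show ?case
      by (induction y rule: tensor_induct)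
        (simp_all add: t simps tensor_mult_of distrib_left distrib_right)
  qed (simp add: t distrib_left distrib_right)
  moreover have "tensor_star s1 s2 (tensor_star s1 s2 x) = x" for x
    by (induction x rule: tensor_induct) (simp_all add: t simps)
  ultimately show ?thesis
    unfolding star_algebra_def by (simp add: t)
qed


section \<open>Multiplier algebras\<close>

text \<open>Multipliers are double centralizers: \<open>L a = m a\<close> and \<open>R a = a m\<close>.\<close>

definition double_centralizer :: "('a::complex_algebra \<Rightarrow> 'a) \<Rightarrow> ('a \<Rightarrow> 'a) \<Rightarrow> bool"
  where "double_centralizer L R \<longleftrightarrow> clinear L \<and> clinear R \<and>
    (\<forall>a b. L (a * b) = L a * b) \<and> (\<forall>a b. R (a * b) = a * R b) \<and> (\<forall>a b. a * L b = R a * b)"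

lemma double_centralizerD:
  assumes "double_centralizer L R"
  shows "clinear L" "clinear R" "L (a * b) = L a * b" "R (a * b) = a * R b" "a * L b = R a * b"
  using assms unfolding double_centralizer_def by blast+

lemma double_centralizerI:
  assumes "clinear L" "clinear R" "\<And>a b. L (a * b) = L a * b" "\<And>a b. R (a * b) = a * R b"
    "\<And>a b. a * L b = R a * b"
  shows "double_centralizer L R"
  using assms unfolding double_centralizer_def by blast

lemma double_centralizer_simps:
  assumes "double_centralizer L R"
  shows "L (a * b) = L a * b" "R (a * b) = a * R b" "a * L b = R a * b"
    "L (a + b) = L a + L b" "R (a + b) = R a + R b"
    "L (c *\<^sub>C a) = c *\<^sub>C L a" "R (c *\<^sub>C a) = c *\<^sub>C R a"
  using double_centralizerD(3-5)[OF assms] clinear_simps[OF double_centralizerD(1)[OF assms]]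
    clinear_simps[OF double_centralizerD(2)[OF assms]] by simp_all

lemma double_centralizer_zero: "double_centralizer (\<lambda>_. 0) (\<lambda>_. 0)"
  by (intro double_centralizerI clinearI) simp_all

typedef (overloaded) 'a multiplier =
    "{(L, R). double_centralizer L (R :: 'a::complex_algebra \<Rightarrow> 'a)}"
  by (rule exI[of _ "(\<lambda>_. 0, \<lambda>_. 0)"]) (simp add: double_centralizer_zero)

setup_lifting type_definition_multiplier

lift_definition lact :: "'a::complex_algebra multiplier \<Rightarrow> 'a \<Rightarrow> 'a" is fst .

lift_definition ract :: "'a::complex_algebra \<Rightarrow> 'a multiplier \<Rightarrow> 'a" is "\<lambda>a m. snd m a" .

lemma multiplier_eqI:
  assumes "\<And>a. lact m a = lact n a" "\<And>a. ract a m = ract a n"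
  shows "m = n"
proof -
  have "fst (Rep_multiplier m) = fst (Rep_multiplier n)"
    "snd (Rep_multiplier m) = snd (Rep_multiplier n)"
    using assms by (simp_all add: fun_eq_iff lact.rep_eq ract.rep_eq)
  then show ?thesis by (metis Rep_multiplier_inject prod.collapse)
qed

lemma clinear_lact: "clinear (lact m)"
  and clinear_ract: "clinear (\<lambda>a. ract a m)"
  using Rep_multiplier[of m] by (auto simp: lact.rep_eq[abs_def] ract.rep_eq double_centralizer_def
      split: prod.splits)

instantiation multiplier :: (complex_algebra) "{complex_algebra, monoid_mult}"
begin

lift_definition zero_multiplier :: "'a multiplier" is "(\<lambda>_. 0, \<lambda>_. 0)"
  by (simp add: double_centralizer_zero)

lift_definition one_multiplier :: "'a multiplier" is "(\<lambda>a. a, \<lambda>a. a)"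
  by (auto intro!: double_centralizerI clinearI)

lift_definition plus_multiplier :: "'a multiplier \<Rightarrow> 'a multiplier \<Rightarrow> 'a multiplier"
  is "\<lambda>(L, R) (L', R'). (\<lambda>a. L a + L' a, \<lambda>a. R a + R' a)"
  subgoal for m n
    by (cases m; cases n) (auto intro!: double_centralizerI clinearI
        simp: double_centralizer_simps scaleC_add_right distrib_left distrib_right)
  done

lift_definition minus_multiplier :: "'a multiplier \<Rightarrow> 'a multiplier \<Rightarrow> 'a multiplier"
  is "\<lambda>(L, R) (L', R'). (\<lambda>a. L a - L' a, \<lambda>a. R a - R' a)"
  subgoal for m n
    by (cases m; cases n) (auto intro!: double_centralizerI clinearI
        simp: double_centralizer_simps complex_vector.scale_right_diff_distrib
          left_diff_distrib right_diff_distrib)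
  done

lift_definition uminus_multiplier :: "'a multiplier \<Rightarrow> 'a multiplier"
  is "\<lambda>(L, R). (\<lambda>a. - L a, \<lambda>a. - R a)"
  subgoal for m
    by (cases m) (auto intro!: double_centralizerI clinearI simp: double_centralizer_simps)
  done

lift_definition scaleC_multiplier :: "complex \<Rightarrow> 'a multiplier \<Rightarrow> 'a multiplier"
  is "\<lambda>c (L, R). (\<lambda>a. c *\<^sub>C L a, \<lambda>a. c *\<^sub>C R a)"
  subgoal for c m
    by (cases m) (auto intro!: double_centralizerI clinearI simp: double_centralizer_simps
        scaleC_add_right scaleC_scaleC mult_scaleC_left mult_scaleC_right mult.commute)
  done

lift_definition times_multiplier :: "'a multiplier \<Rightarrow> 'a multiplier \<Rightarrow> 'a multiplier"
  is "\<lambda>(L, R) (L', R'). (\<lambda>a. L (L' a), \<lambda>a. R' (R a))"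
  subgoal for m n
    by (cases m; cases n) (auto intro!: double_centralizerI clinearI simp: double_centralizer_simps)
  done

lemma multiplier_act:
  fixes m n :: "'a multiplier"
  shows "lact 0 a = 0" "ract a (0 :: 'a multiplier) = 0"
    "lact 1 a = a" "ract a (1 :: 'a multiplier) = a"
    "lact (m + n) a = lact m a + lact n a" "ract a (m + n) = ract a m + ract a n"
    "lact (m - n) a = lact m a - lact n a" "ract a (m - n) = ract a m - ract a n"
    "lact (- m) a = - lact m a" "ract a (- m) = - ract a m"
    "lact (c *\<^sub>C m) a = c *\<^sub>C lact m a" "ract a (c *\<^sub>C m) = c *\<^sub>C ract a m"
    "lact (m * n) a = lact m (lact n a)" "ract a (m * n) = ract (ract a m) n"
  by (transfer; simp add: case_prod_unfold)+

instance
  by standard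
    (rule multiplier_eqI; simp add: multiplier_act clinear_simps[OF clinear_lact]
      clinear_simps[OF clinear_ract] algebra_simps scaleC_add_right scaleC_add_left
      scaleC_scaleC scaleC_one)+

end

lift_definition mult_of :: "'a::complex_algebra \<Rightarrow> 'a multiplier"
  is "\<lambda>a. (\<lambda>b. a * b, \<lambda>b. b * a)"
  by (auto intro!: double_centralizerI clinearI
      simp: distrib_left distrib_right mult_scaleC_left mult_scaleC_right mult.assoc)

text \<open>The embedding of \<open>M(A) \<otimes> M(B)\<close> in \<open>M(A \<otimes> B)\<close>, on elementary tensors.\<close>

lemma bilinear_pair:
  assumes "clinear f" "clinear g"
  shows "cbilinear (\<lambda>a b. f a \<otimes> g b)"
  unfolding cbilinear_def
  by (auto intro!: clinearI simp: clinear_simps[OF assms(1)] clinear_simps[OF assms(2)] tensor_of_add_left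
      tensor_of_add_right tensor_of_scaleC_left tensor_of_scaleC_right)

lift_definition mtensor ::
    "'a::complex_algebra multiplier \<Rightarrow> 'b::complex_algebra multiplier \<Rightarrow> ('a \<otimes> 'b) multiplier"
  is "\<lambda>(L, R) (L', R'). (tensor_lift (\<lambda>a b. L a \<otimes> L' b), tensor_lift (\<lambda>a b. R a \<otimes> R' b))"
proof -
  fix m :: "('a \<Rightarrow> 'a) \<times> ('a \<Rightarrow> 'a)" and n :: "('b \<Rightarrow> 'b) \<times> ('b \<Rightarrow> 'b)"
  obtain L R L' R' where mn: "m = (L, R)" "n = (L', R')" by (metis surj_pair)
  assume "m \<in> {(L, R). double_centralizer L R}" "n \<in> {(L, R). double_centralizer L R}"
  then have dc: "double_centralizer L R" "double_centralizer L' R'" by (simp_all add: mn)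
  note lin = double_centralizerD(1,2)[OF dc(1)] double_centralizerD(1,2)[OF dc(2)]
  note eqs = double_centralizer_simps[OF dc(1)] double_centralizer_simps[OF dc(2)]
  let ?L = "tensor_lift (\<lambda>a b. L a \<otimes> L' b)" and ?R = "tensor_lift (\<lambda>a b. R a \<otimes> R' b)"
  have linL: "clinear ?L" and linR: "clinear ?R"
    by (intro clinear_tensor_lift bilinear_pair lin)+
  have ofs: "?L (a \<otimes> b) = L a \<otimes> L' b" "?R (a \<otimes> b) = R a \<otimes> R' b" for a b
    by (intro tensor_lift_of bilinear_pair lin)+
  have "?L (s * t) = ?L s * t \<and> ?R (s * t) = s * ?R t \<and> s * ?L t = ?R s * t" for s t
  proof (induction s rule: tensor_induct)
    case (of a b)
    show ?case
      by (induction t rule: tensor_induct)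
        (simp_all add: distrib_left clinear_add[OF linL] clinear_add[OF linR] ofs tensor_mult_of eqs)
  qed (simp add: distrib_right clinear_add[OF linL] clinear_add[OF linR])
  then have "double_centralizer ?L ?R"
    by (intro double_centralizerI linL linR) blast+
  then show "(case m of (L, R) \<Rightarrow> \<lambda>(L', R').
      (tensor_lift (\<lambda>a b. L a \<otimes> L' b), tensor_lift (\<lambda>a b. R a \<otimes> R' b))) n
    \<in> {(L, R). double_centralizer L R}"
    by (simp add: mn)
qed

lift_definition multiplier_assoc ::
    "(('a::complex_algebra \<otimes> 'b::complex_algebra) \<otimes> 'c::complex_algebra) multiplier
      \<Rightarrow> ('a \<otimes> ('b \<otimes> 'c)) multiplier"
  is "\<lambda>(L, R). (\<lambda>t. tensor_assoc (L (tensor_assoc_inv t)), \<lambda>t. tensor_assoc (R (tensor_assoc_inv t)))"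
proof -
  fix m :: "(('a \<otimes> 'b) \<otimes> 'c \<Rightarrow> ('a \<otimes> 'b) \<otimes> 'c) \<times> (('a \<otimes> 'b) \<otimes> 'c \<Rightarrow> ('a \<otimes> 'b) \<otimes> 'c)"
  obtain L R where m: "m = (L, R)" by (metis surj_pair)
  assume "m \<in> {(L, R). double_centralizer L R}"
  then have dc: "double_centralizer L R" by (simp add: m)
  have "double_centralizer (\<lambda>t. tensor_assoc (L (tensor_assoc_inv t)))
    (\<lambda>t. tensor_assoc (R (tensor_assoc_inv t)))"
  proof (rule double_centralizerI)
    fix s t :: "'a \<otimes> 'b \<otimes> 'c"
    show "tensor_assoc (L (tensor_assoc_inv (s * t))) = tensor_assoc (L (tensor_assoc_inv s)) * t"
      "tensor_assoc (R (tensor_assoc_inv (s * t))) = s * tensor_assoc (R (tensor_assoc_inv t))"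
      by (simp_all add: tensor_assoc_inv_mult double_centralizerD(3,4)[OF dc] tensor_assoc_mult)
    have "s * tensor_assoc (L (tensor_assoc_inv t)) =
        tensor_assoc (tensor_assoc_inv s * L (tensor_assoc_inv t))"
      by (simp add: tensor_assoc_mult)
    also have "\<dots> = tensor_assoc (R (tensor_assoc_inv s)) * t"
      by (simp add: double_centralizerD(5)[OF dc] tensor_assoc_mult)
    finally show "s * tensor_assoc (L (tensor_assoc_inv t)) = tensor_assoc (R (tensor_assoc_inv s)) * t" .
  qed (rule clinearI; simp add: clinear_simps[OF clinear_tensor_assoc]
      clinear_simps[OF clinear_tensor_assoc_inv] double_centralizer_simps[OF dc])+
  then show "(case m of (L, R) \<Rightarrow> (\<lambda>t. tensor_assoc (L (tensor_assoc_inv t)),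
      \<lambda>t. tensor_assoc (R (tensor_assoc_inv t)))) \<in> {(L, R). double_centralizer L R}"
    by (simp add: m)
qed

text \<open>\<open>M(A)\<close> is a \<open>*\<close>-algebra with \<open>m* a = (a* m)*\<close> and \<open>a m* = (m a*)*\<close>; the pair below
  is a multiplier whenever \<open>star\<close> is an involution.\<close>

definition multiplier_star :: "('a::complex_algebra \<Rightarrow> 'a) \<Rightarrow> 'a multiplier \<Rightarrow> 'a multiplier"
  where "multiplier_star star m =
    Abs_multiplier (\<lambda>a. star (ract (star a) m), \<lambda>a. star (lact m (star a)))"

lemma multiplier_star_act:
  assumes "star_algebra star"
  shows "lact (multiplier_star star m) a = star (ract (star a) m)"
    and "ract a (multiplier_star star m) = star (lact m (star a))"
proof -
  note star = assms[unfolded star_algebra_def, THEN conjunct1, rule_format]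
    assms[unfolded star_algebra_def, THEN conjunct2, THEN conjunct1, rule_format]
    assms[unfolded star_algebra_def, THEN conjunct2, THEN conjunct2, THEN conjunct1, rule_format]
    assms[unfolded star_algebra_def, THEN conjunct2, THEN conjunct2, THEN conjunct2, rule_format]
  have dc: "double_centralizer (lact m) (\<lambda>a. ract a m)"
    using Rep_multiplier[of m] by (auto simp: lact.rep_eq[abs_def] ract.rep_eq split: prod.splits)
  note m = double_centralizer_simps[OF dc]
  have "double_centralizer (\<lambda>a. star (ract (star a) m)) (\<lambda>a. star (lact m (star a)))"
  proof (intro double_centralizerI clinearI)
    fix a b
    have "a * star (ract (star b) m) = star (ract (star b) m * star a)" by (simp add: star)
    also have "\<dots> = star (star b * lact m (star a))" by (simp add: m)
    finally show "a * star (ract (star b) m) = star (lact m (star a)) * b" by (simp add: star)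
  qed (simp_all add: star m)
  then have "Rep_multiplier (multiplier_star star m) =
      (\<lambda>a. star (ract (star a) m), \<lambda>a. star (lact m (star a)))"
    unfolding multiplier_star_def by (simp add: Abs_multiplier_inverse)
  then show "lact (multiplier_star star m) a = star (ract (star a) m)"
    "ract a (multiplier_star star m) = star (lact m (star a))"
    by (simp_all add: lact.rep_eq ract.rep_eq)
qed

definition nondegenerate_hom :: "('a::complex_algebra \<Rightarrow> 'b::complex_algebra multiplier) \<Rightarrow> bool"
  where "nondegenerate_hom \<alpha> \<longleftrightarrow> algebra_hom \<alpha> \<and>
    cspan {lact (\<alpha> a) b | a b. True} = UNIV \<and> cspan {ract b (\<alpha> a) | a b. True} = UNIV"

text \<open>The unique unital extension \<open>M(A) \<rightarrow> M(B)\<close> of a non-degenerate homomorphism \<open>A \<rightarrow> M(B)\<close>.\<close>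

definition multiplier_ext ::
    "('a::complex_algebra \<Rightarrow> 'b::complex_algebra multiplier) \<Rightarrow> 'a multiplier \<Rightarrow> 'b multiplier"
  where "multiplier_ext \<alpha> =
    (THE \<beta>. algebra_hom \<beta> \<and> \<beta> 1 = 1 \<and> (\<forall>a. \<beta> (mult_of a) = \<alpha> a))"

text \<open>\<open>\<alpha> \<otimes> \<beta> : A \<otimes> B \<rightarrow> M(C \<otimes> D)\<close> for homomorphisms \<open>\<alpha> : A \<rightarrow> M(C)\<close> and \<open>\<beta> : B \<rightarrow> M(D)\<close>.\<close>

definition hom_tensor ::
    "('a::complex_algebra \<Rightarrow> 'c::complex_algebra multiplier) \<Rightarrow>
     ('b::complex_algebra \<Rightarrow> 'd::complex_algebra multiplier) \<Rightarrow> 'a \<otimes> 'b \<Rightarrow> ('c \<otimes> 'd) multiplier"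
  where "hom_tensor \<alpha> \<beta> = tensor_lift (\<lambda>a b. mtensor (\<alpha> a) (\<beta> b))"


section \<open>Multiplier Hopf algebras\<close>

text \<open>In the coassociativity axiom, \<open>inv mult_of\<close> reads an element of \<open>A \<otimes> A \<subseteq> M(A \<otimes> A)\<close> as an
  element of \<open>A \<otimes> A\<close>, and \<open>hom_tensor \<Delta> mult_of\<close> is \<open>\<Delta> \<otimes> \<iota>\<close>.\<close>

definition multiplier_hopf_algebra ::
    "('a::nondegenerate_algebra \<Rightarrow> ('a \<otimes> 'a) multiplier) \<Rightarrow> bool"
  where "multiplier_hopf_algebra \<Delta> \<longleftrightarrow>
    algebra_hom \<Delta> \<and>
    (\<forall>a b. \<Delta> a * mtensor 1 (mult_of b) \<in> range mult_of) \<and>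
    (\<forall>a b. mtensor (mult_of a) 1 * \<Delta> b \<in> range mult_of) \<and>
    (\<forall>a b c.
      multiplier_assoc (mtensor (mtensor (mult_of a) 1) 1 *
        hom_tensor \<Delta> mult_of (inv mult_of (\<Delta> b * mtensor 1 (mult_of c)))) =
      hom_tensor mult_of \<Delta> (inv mult_of (mtensor (mult_of a) 1 * \<Delta> b)) *
        mtensor 1 (mtensor 1 (mult_of c))) \<and>
    bij_betw (tensor_lift (\<lambda>a b. \<Delta> a * mtensor 1 (mult_of b))) UNIV (range mult_of) \<and>
    bij_betw (tensor_lift (\<lambda>a b. mtensor (mult_of a) 1 * \<Delta> b)) UNIV (range mult_of)"

definition multiplier_hopf_star_algebra ::
    "('a::nondegenerate_algebra \<Rightarrow> ('a \<otimes> 'a) multiplier) \<Rightarrow> ('a \<Rightarrow> 'a) \<Rightarrow> bool"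
  where "multiplier_hopf_star_algebra \<Delta> star \<longleftrightarrow>
    multiplier_hopf_algebra \<Delta> \<and> star_algebra star \<and>
    (\<forall>a. \<Delta> (star a) = multiplier_star (tensor_star star star) (\<Delta> a))"

definition direct_sum_decomposition :: "('g \<Rightarrow> 'a::complex_vector set) \<Rightarrow> bool"
  where "direct_sum_decomposition A \<longleftrightarrow>
    (\<forall>a. \<exists>!f. finite {p. f p \<noteq> 0} \<and> (\<forall>p. f p \<in> A p) \<and> a = (\<Sum>p | f p \<noteq> 0. f p))"

text \<open>The class \<^class>\<open>group_add\<close> does not assume commutativity: \<open>p + q\<close> is the product \<open>pq\<close>.\<close>

definition cograding ::
    "('a::nondegenerate_algebra \<Rightarrow> ('a \<otimes> 'a) multiplier) \<Rightarrow> ('g::group_add \<Rightarrow> 'a set) \<Rightarrow> bool"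
  where "cograding \<Delta> A \<longleftrightarrow>
    (\<forall>p. subalgebra (A p) \<and> A p \<noteq> {0}) \<and>
    direct_sum_decomposition A \<and>
    (\<forall>p q. p \<noteq> q \<longrightarrow> (\<forall>a\<in>A p. \<forall>b\<in>A q. a * b = 0)) \<and>
    (\<forall>p q.
      cspan {\<Delta> a * mtensor 1 (mult_of b) | a b. a \<in> A (p + q) \<and> b \<in> A q} =
        mult_of ` cspan {a \<otimes> b | a b. a \<in> A p \<and> b \<in> A q} \<and>
      cspan {mtensor (mult_of a) 1 * \<Delta> b | a b. a \<in> A p \<and> b \<in> A (p + q)} =
        mult_of ` cspan {a \<otimes> b | a b. a \<in> A p \<and> b \<in> A q})"

text \<open>A function \<open>F\<close> on \<open>G \<times> H\<close> as a multiplier of \<open>K(G) \<otimes> K(H)\<close>, acting by pointwise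
  multiplication: \<open>F \<cdot> (\<delta>\<^sub>p \<otimes> \<delta>\<^sub>q) = F(p, q) (\<delta>\<^sub>p \<otimes> \<delta>\<^sub>q)\<close>.\<close>

definition pointwise_mult ::
    "('g \<times> 'h \<Rightarrow> complex) \<Rightarrow> 'g finsupp \<otimes> 'h finsupp \<Rightarrow> 'g finsupp \<otimes> 'h finsupp"
  where "pointwise_mult F =
    tensor_lift (\<lambda>f g. finsupp_lift (\<lambda>p. finsupp_lift (\<lambda>q. F (p, q) *\<^sub>C (delta p \<otimes> delta q)) g) f)"

lemma bilinear_pointwise:
  "cbilinear (\<lambda>f g. finsupp_lift (\<lambda>p. finsupp_lift (\<lambda>q. F (p, q) *\<^sub>C (delta p \<otimes> delta q)) g) f)"
  unfolding cbilinear_def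
  by (auto intro!: clinearI simp: clinear_add[OF clinear_finsupp_lift]
      clinear_scaleC[OF clinear_finsupp_lift] finsupp_lift_add_fun finsupp_lift_scaleC_fun)

lemma clinear_pointwise_mult: "clinear (pointwise_mult F)"
  unfolding pointwise_mult_def by (rule clinear_tensor_lift[OF bilinear_pointwise])

lemma pointwise_mult_delta:
  "pointwise_mult F (delta p \<otimes> delta q) = F (p, q) *\<^sub>C (delta p \<otimes> delta q)"
  by (simp add: pointwise_mult_def tensor_lift_of[OF bilinear_pointwise])

lemma tensor_delta_induct [case_names add scale delta]:
  assumes "\<And>x y. P x \<Longrightarrow> P y \<Longrightarrow> P (x + y)" "\<And>c x. P x \<Longrightarrow> P (c *\<^sub>C x)"
    "\<And>p q. P (delta p \<otimes> delta q)"
  shows "P (t :: 'g finsupp \<otimes> 'h finsupp)"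
proof (induction t rule: tensor_induct)
  case (of f g)
  have P0: "P 0" using assms(2)[OF assms(3), of 0] by simp
  have z: "0 \<otimes> y = 0" "x \<otimes> 0 = 0" for x :: "'g finsupp" and y :: "'h finsupp"
    using tensor_of_scaleC_left[of 0 0 y] tensor_of_scaleC_right[of x 0 0] by simp_all
  show ?case
  proof (induction f rule: finsupp_induct)
    case (delta p)
    show ?case
      by (induction g rule: finsupp_induct)
        (simp_all add: P0 z tensor_of_add_right tensor_of_scaleC_right assms)
  qed (simp_all add: P0 z tensor_of_add_left tensor_of_scaleC_left assms)
qed (rule assms)

lemma delta_mult: "delta p * delta q = (if p = q then delta p else 0)"
  by transfer auto

lemma pointwise_mult_mult:
  "pointwise_mult F (s * t) = pointwise_mult F s * t"
  "pointwise_mult F (s * t) = s * pointwise_mult F t"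
proof -
  note lin = clinear_simps[OF clinear_pointwise_mult]
  have z: "0 \<otimes> y = 0" "x \<otimes> 0 = 0" for x :: "'a finsupp" and y :: "'b finsupp"
    using tensor_of_scaleC_left[of 0 0 y] tensor_of_scaleC_right[of x 0 0] by simp_all
  have d: "pointwise_mult F ((delta p \<otimes> delta q) * t) = pointwise_mult F (delta p \<otimes> delta q) * t"
    "pointwise_mult F ((delta p \<otimes> delta q) * t) = (delta p \<otimes> delta q) * pointwise_mult F t" for p q
    by (induction t rule: tensor_delta_induct)
      (auto simp: pointwise_mult_delta tensor_mult_of delta_mult z distrib_left mult_scaleC_left
        mult_scaleC_right lin)
  show "pointwise_mult F (s * t) = pointwise_mult F s * t"
    by (induction s rule: tensor_delta_induct) (simp_all add: d(1) distrib_right mult_scaleC_left lin)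
  show "pointwise_mult F (s * t) = s * pointwise_mult F t"
    by (induction s rule: tensor_delta_induct) (simp_all add: d(2) distrib_right mult_scaleC_left lin)
qed

lift_definition function_multiplier ::
    "('g \<times> 'h \<Rightarrow> complex) \<Rightarrow> ('g finsupp \<otimes> 'h finsupp) multiplier"
  is "\<lambda>F. (pointwise_mult F, pointwise_mult F)"
  by (auto intro!: double_centralizerI clinear_pointwise_mult
      simp: pointwise_mult_mult(1)[symmetric] pointwise_mult_mult(2)[symmetric])

definition comult_K :: "'g::group_add finsupp \<Rightarrow> ('g finsupp \<otimes> 'g finsupp) multiplier"
  where "comult_K f = function_multiplier (\<lambda>(p, q). fun_of f (p + q))"

end

theory Submission
  imports Defs
begin

text \<open>Both sides of the equivalence amount to one family \<open>(\<pi>\<^sub>p)\<close>, indexed by \<open>G\<close>, of non-zero central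
  orthogonal idempotents in \<open>M(A)\<close> with \<open>A = \<Oplus>\<^sub>p \<pi>\<^sub>pA\<close> (\<open>central_partition\<close>). Given \<open>\<gamma>\<close>, put
  \<open>\<pi>\<^sub>p = \<gamma>(\<delta>\<^sub>p)\<close>; given a decomposition of \<open>A\<close> into subalgebras that annihilate each other, the
  projections onto the summands are such multipliers, and \<open>\<gamma>(f) = \<Sum>\<^sub>p f(p)\<pi>\<^sub>p\<close>. The components
  and the homomorphism are related by \<open>A\<^sub>p = \<pi>\<^sub>pA\<close>, and \<open>\<gamma>(f)\<close> acts on \<open>A\<^sub>p\<close> as the scalar \<open>f(p)\<close>.

  It remains to match the conditions on the coproduct. The multiplier \<open>(\<gamma> \<otimes> \<gamma>)(\<Delta>\<^sub>G(f))\<close> acts on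
  \<open>A\<^sub>p \<otimes> A\<^sub>q\<close> as \<open>f(pq)\<close> (\<open>comult_K_ext_mult\<close>), while \<open>\<Delta>(\<gamma>(f))\<close> acts on \<open>\<Delta>(A\<^sub>p\<^sub>q)(1 \<otimes> A\<^sub>q)\<close> as \<open>f(pq)\<close>.
  If these spaces coincide, so do the multipliers (\<open>comultiplicative_of_cograding\<close>). Conversely, if
  the multipliers coincide for \<open>f = \<delta>\<^sub>p\<^sub>q\<close>, then multiplication by \<open>1 \<otimes> \<pi>\<^sub>q\<close> singles out
  \<open>\<pi>\<^sub>p \<otimes> \<pi>\<^sub>q\<close>, and applying this to \<open>\<Delta>(A)(1 \<otimes> A) = A \<otimes> A\<close> gives
  \<open>\<Delta>(A\<^sub>p\<^sub>q)(1 \<otimes> A\<^sub>q) = A\<^sub>p \<otimes> A\<^sub>q\<close> (\<open>cograding_of_comultiplicative_partition\<close>).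

  For these arguments \<open>\<Delta>\<close> and \<open>\<gamma> \<otimes> \<gamma>\<close> have to extend to multiplier algebras. Non-degenerate
  homomorphisms into multipliers of a non-degenerate algebra extend uniquely
  (\<open>multiplier_ext_unique\<close>). The tensor product of non-degenerate algebras is non-degenerate, by
  slicing with linear functionals, and \<open>\<Delta>\<close> is non-degenerate because \<open>A\<^sup>2 = A\<close>
  (\<open>multiplier_hopf_algebra_idempotent\<close>).

  In the \<open>*\<close>-case every \<open>A\<^sub>p\<close> is stable under the involution, so the scalar by which
  \<open>\<gamma>(f)\<^sup>*\<close> acts on \<open>A\<^sub>p\<close> is the conjugate of \<open>f(p)\<close> (\<open>finsupp_lift_star\<close>).\<close>

section \<open>Linear functionals and slices of tensors\<close>

definition linear_functional :: "('a::complex_vector \<Rightarrow> complex) \<Rightarrow> bool"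
  where "linear_functional \<phi> \<longleftrightarrow>
    (\<forall>x y. \<phi> (x + y) = \<phi> x + \<phi> y) \<and> (\<forall>c x. \<phi> (c *\<^sub>C x) = c * \<phi> x)"

lemma linear_functionalD:
  assumes "linear_functional \<phi>"
  shows "\<phi> (x + y) = \<phi> x + \<phi> y" "\<phi> (c *\<^sub>C x) = c * \<phi> x"
  using assms by (auto simp: linear_functional_def)

lemma linear_functional_representation:
  assumes "complex_vector.independent B" "cspan B = UNIV"
  shows "linear_functional (\<lambda>x. complex_vector.representation B x b)"
  using assms
  by (simp add: linear_functional_def complex_vector.representation_add
      complex_vector.representation_scale)

text \<open>Extend a basis of \<open>S\<close> by \<open>x\<close> and then to a basis of the whole space; the coordinate at \<open>x\<close> is
  the required functional.\<close>

lemma separating_functional: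
  assumes "csubspace S" "x \<notin> S"
  obtains \<phi> where "linear_functional \<phi>" "\<phi> x = 1" "\<And>y. y \<in> S \<Longrightarrow> \<phi> y = 0"
proof -
  obtain B where B: "B \<subseteq> S" "complex_vector.independent B" "S \<subseteq> cspan B"
    by (rule complex_vector.maximal_independent_subset)
  have span: "cspan B = S"
    using B assms(1) by (metis complex_vector.span_subspace)
  then have "complex_vector.independent (insert x B)"
    using B(2) assms(2) by (metis complex_vector.independent_insertI)
  then obtain E where E: "insert x B \<subseteq> E" "complex_vector.independent E" "cspan E = UNIV"
    by (metis complex_vector.extend_basis_superset complex_vector.independent_extend_basis
        complex_vector.span_extend_basis)
  show thesis
  proof (rule that[of "\<lambda>v. complex_vector.representation E v x"])
    show "linear_functional (\<lambda>v. complex_vector.representation E v x)"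
      by (rule linear_functional_representation[OF E(2,3)])
    show "complex_vector.representation E x x = 1"
      using E by (simp add: complex_vector.representation_basis)
    fix y assume "y \<in> S"
    then have "complex_vector.representation E y = complex_vector.representation B y"
      using E(1,2) span by (auto intro!: complex_vector.representation_extend)
    then show "complex_vector.representation E y x = 0"
      using assms(2) B(1) complex_vector.representation_ne_zero[of B y x] by auto
  qed
qed

text \<open>The slice maps \<open>\<iota> \<otimes> \<phi>\<close> and \<open>\<phi> \<otimes> \<iota>\<close>, with \<open>\<complex> \<otimes> V\<close> identified with \<open>V\<close>. Their values on general
  tensors are meaningful only for linear \<open>\<phi>\<close>, because \<open>tensor_lift\<close> needs a bilinear map.\<close>

definition slice_right :: "('b::complex_vector \<Rightarrow> complex) \<Rightarrow> 'a::complex_vector \<otimes> 'b \<Rightarrow> 'a"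
  where "slice_right \<phi> = tensor_lift (\<lambda>a b. \<phi> b *\<^sub>C a)"

definition slice_left :: "('a::complex_vector \<Rightarrow> complex) \<Rightarrow> 'a \<otimes> 'b::complex_vector \<Rightarrow> 'b"
  where "slice_left \<phi> = tensor_lift (\<lambda>a b. \<phi> a *\<^sub>C b)"

lemma slice_right:
  assumes "linear_functional \<phi>"
  shows "clinear (slice_right \<phi>)" "slice_right \<phi> (a \<otimes> b) = \<phi> b *\<^sub>C a"
proof -
  have "cbilinear (\<lambda>a b. \<phi> b *\<^sub>C a)"
    unfolding cbilinear_def using linear_functionalD[OF assms]
    by (auto intro!: clinearI
        simp: scaleC_add_left scaleC_add_right scaleC_scaleC mult.commute)
  then show "clinear (slice_right \<phi>)" "slice_right \<phi> (a \<otimes> b) = \<phi> b *\<^sub>C a"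
    unfolding slice_right_def by (rule clinear_tensor_lift, rule tensor_lift_of)
qed

lemma slice_left:
  assumes "linear_functional \<phi>"
  shows "clinear (slice_left \<phi>)" "slice_left \<phi> (a \<otimes> b) = \<phi> a *\<^sub>C b"
proof -
  have "cbilinear (\<lambda>a b. \<phi> a *\<^sub>C b)"
    unfolding cbilinear_def using linear_functionalD[OF assms]
    by (auto intro!: clinearI
        simp: scaleC_add_left scaleC_add_right scaleC_scaleC mult.commute)
  then show "clinear (slice_left \<phi>)" "slice_left \<phi> (a \<otimes> b) = \<phi> a *\<^sub>C b"
    unfolding slice_left_def by (rule clinear_tensor_lift, rule tensor_lift_of)
qed

lemma tensor_of_zero [simp]: "0 \<otimes> b = 0" "a \<otimes> 0 = 0"
  using tensor_of_scaleC_left[of 0 0 b] tensor_of_scaleC_right[of a 0 0] by simp_all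

lemma tensor_of_sum_right: "a \<otimes> sum f S = (\<Sum>i\<in>S. a \<otimes> f i)"
  by (induction S rule: infinite_finite_induct) (simp_all add: tensor_of_add_right)

text \<open>For a basis \<open>E\<close> of the second factor with coordinate functionals \<open>r\<^sub>e\<close>, every tensor is the
  finite sum of \<open>(\<iota> \<otimes> r\<^sub>e)(t) \<otimes> e\<close>, so it is determined by its slices. In the induction the
  claim is made for all finite sets containing some finite \<open>F\<close>, since the supports of two
  tensors have to be merged.\<close>

lemma tensor_eq_0_if_slices_right:
  fixes t :: "'a::complex_vector \<otimes> 'b::complex_vector"
  assumes "\<And>\<phi>. linear_functional \<phi> \<Longrightarrow> slice_right \<phi> t = 0"
  shows "t = 0"
proof -
  obtain E :: "'b set" where E: "complex_vector.independent E" "cspan E = UNIV"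
    using complex_vector.independent_extend_basis complex_vector.span_extend_basis
      complex_vector.independent_empty by blast
  let ?r = "\<lambda>e b. complex_vector.representation E b e"
  note fl = linear_functional_representation[OF E]
  have "\<exists>F. finite F \<and> (\<forall>F'. finite F' \<longrightarrow> F \<subseteq> F' \<longrightarrow>
      t = (\<Sum>e\<in>F'. slice_right (?r e) t \<otimes> e))" for t :: "'a \<otimes> 'b"
  proof (induction t rule: tensor_induct)
    case (add x y)
    then obtain F F' where
      "finite F" "\<forall>F'. finite F' \<longrightarrow> F \<subseteq> F' \<longrightarrow> x = (\<Sum>e\<in>F'. slice_right (?r e) x \<otimes> e)"
      "finite F'" "\<forall>F''. finite F'' \<longrightarrow> F' \<subseteq> F'' \<longrightarrow> y = (\<Sum>e\<in>F''. slice_right (?r e) y \<otimes> e)"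
      by blast
    then show ?case
      by (intro exI[of _ "F \<union> F'"])
        (auto simp: clinear_add[OF slice_right(1)[OF fl]] tensor_of_add_left sum.distrib)
  next
    case (of a b)
    let ?F = "{e. ?r e b \<noteq> 0}"
    have "a \<otimes> b = (\<Sum>e\<in>F'. slice_right (?r e) (a \<otimes> b) \<otimes> e)" if "finite F'" "?F \<subseteq> F'" for F'
    proof -
      have "b = (\<Sum>e\<in>?F. ?r e b *\<^sub>C e)"
        using E by (simp add: complex_vector.sum_nonzero_representation_eq)
      also have "\<dots> = (\<Sum>e\<in>F'. ?r e b *\<^sub>C e)"
        by (rule sum.mono_neutral_left) (use that in auto)
      finally have "a \<otimes> b = a \<otimes> (\<Sum>e\<in>F'. ?r e b *\<^sub>C e)" by (rule arg_cong)
      also have "\<dots> = (\<Sum>e\<in>F'. slice_right (?r e) (a \<otimes> b) \<otimes> e)"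
        by (simp add: tensor_of_sum_right slice_right(2)[OF fl] tensor_of_scaleC_left
            tensor_of_scaleC_right)
      finally show ?thesis .
    qed
    then show ?case
      by (intro exI[of _ ?F]) (simp add: complex_vector.finite_representation)
  qed
  then obtain F where "t = (\<Sum>e\<in>F. slice_right (?r e) t \<otimes> e)" by blast
  then show ?thesis using assms[OF fl] by simp
qed

definition tensor_flip :: "'a::complex_vector \<otimes> 'b::complex_vector \<Rightarrow> 'b \<otimes> 'a"
  where "tensor_flip = tensor_lift (\<lambda>a b. b \<otimes> a)"

lemma bilinear_flip: "cbilinear (\<lambda>a b. b \<otimes> a)"
  unfolding cbilinear_def by (auto intro!: clinearI simp: tensor_of_add_left
    tensor_of_add_right tensor_of_scaleC_left tensor_of_scaleC_right)

lemma tensor_flip: "clinear tensor_flip" "tensor_flip (a \<otimes> b) = b \<otimes> a"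
  unfolding tensor_flip_def
  by (rule clinear_tensor_lift[OF bilinear_flip], rule tensor_lift_of[OF bilinear_flip])

lemma tensor_flip_flip [simp]: "tensor_flip (tensor_flip t) = t"
  by (induction t rule: tensor_induct) (simp_all add: tensor_flip clinear_add[OF tensor_flip(1)])

lemma tensor_eq_0_if_slices_left:
  assumes "\<And>\<phi>. linear_functional \<phi> \<Longrightarrow> slice_left \<phi> t = 0"
  shows "t = 0"
proof -
  have "tensor_flip t = 0"
  proof (rule tensor_eq_0_if_slices_right)
    fix \<phi> :: "'a \<Rightarrow> complex" assume \<phi>: "linear_functional \<phi>"
    have "slice_right \<phi> (tensor_flip t) = slice_left \<phi> t"
      by (rule clinear_tensor_eqI[where t = t])
        (simp_all add: clinear_comp[OF slice_right(1)[OF \<phi>] tensor_flip(1)] slice_right[OF \<phi>]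
          slice_left[OF \<phi>] tensor_flip)
    then show "slice_right \<phi> (tensor_flip t) = 0" by (simp add: assms \<phi>)
  qed
  then show ?thesis using tensor_flip_flip[of t] by (simp add: clinear_0[OF tensor_flip(1)])
qed


section \<open>Multipliers of non-degenerate algebras and of tensor products\<close>

text \<open>The three relations between the two actions of a multiplier are associativity laws:
  \<open>m(ab) = (ma)b\<close>, \<open>(ab)m = a(bm)\<close> and \<open>a(mb) = (am)b\<close>.\<close>

lemma multiplier_assoc_act:
  "lact m (a * b) = lact m a * b" "ract (a * b) m = a * ract b m" "a * lact m b = ract a m * b"
proof -
  have "double_centralizer (lact m) (\<lambda>a. ract a m)"
    using Rep_multiplier[of m] by (auto simp: lact.rep_eq[abs_def] ract.rep_eq split: prod.splits)
  from double_centralizerD(3-5)[OF this]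
  show "lact m (a * b) = lact m a * b" "ract (a * b) m = a * ract b m" "a * lact m b = ract a m * b"
    by blast+
qed

lemma mult_of_act [simp]: "lact (mult_of a) b = a * b" "ract b (mult_of a) = b * a"
  by (transfer; simp)+

lemmas act_simps = multiplier_act clinear_simps[OF clinear_lact] clinear_simps[OF clinear_ract]

lemma clinear_mult_of: "clinear mult_of"
  by (rule clinearI; rule multiplier_eqI)
    (simp_all add: act_simps distrib_left distrib_right mult_scaleC_left mult_scaleC_right)

lemma multiplier_times_mult_of: "m * mult_of a = mult_of (lact m a)"
  by (rule multiplier_eqI) (simp_all add: multiplier_act multiplier_assoc_act)

lemma mult_of_times_multiplier: "mult_of a * m = mult_of (ract a m)"
  by (rule multiplier_eqI) (simp_all add: multiplier_act multiplier_assoc_act)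

lemma mtensor_act [simp]:
  "lact (mtensor m n) (a \<otimes> b) = lact m a \<otimes> lact n b"
  "ract (a \<otimes> b) (mtensor m n) = ract a m \<otimes> ract b n"
proof -
  have "cbilinear (\<lambda>a b. lact m a \<otimes> lact n b)" "cbilinear (\<lambda>a b. ract a m \<otimes> ract b n)"
    by (intro bilinear_pair clinear_lact clinear_ract)+
  note this[THEN tensor_lift_of]
  then show "lact (mtensor m n) (a \<otimes> b) = lact m a \<otimes> lact n b"
    "ract (a \<otimes> b) (mtensor m n) = ract a m \<otimes> ract b n"
    by (simp_all add: lact.rep_eq ract.rep_eq mtensor.rep_eq case_prod_unfold)
qed

lemma multiplier_tensor_eqI:
  assumes "\<And>a b. lact m (a \<otimes> b) = lact n (a \<otimes> b)" "\<And>a b. ract (a \<otimes> b) m = ract (a \<otimes> b) n"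
  shows "m = n"
  by (rule multiplier_eqI; rule clinear_tensor_eqI) (simp_all add: clinear_lact clinear_ract assms)

lemma bilinear_mtensor: "cbilinear mtensor"
  unfolding cbilinear_def
  by (intro conjI allI clinearI; rule multiplier_tensor_eqI)
    (simp_all add: act_simps tensor_of_add_left tensor_of_add_right tensor_of_scaleC_left
      tensor_of_scaleC_right)

lemma mtensor_mult: "mtensor m n * mtensor m' n' = mtensor (m * m') (n * n')"
  by (rule multiplier_tensor_eqI) (simp_all add: multiplier_act)

lemma mtensor_mult_of: "mtensor (mult_of a) (mult_of b) = mult_of (a \<otimes> b)"
  by (rule multiplier_tensor_eqI) (simp_all add: tensor_mult_of)

text \<open>Slicing the first leg reduces joint injectivity of the maps \<open>\<iota> \<otimes> L\<^sub>i\<close> to that of the maps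
  \<open>L\<^sub>i\<close>. Used below with multiplications, this carries non-degeneracy over to tensor products.\<close>

lemma tensor_eq_0_if_left_factor:
  fixes L :: "'i \<Rightarrow> 'b::complex_vector \<Rightarrow> 'c::complex_vector"
  assumes lin: "\<And>i. clinear (L i)" and sep: "\<And>b. (\<And>i. L i b = 0) \<Longrightarrow> b = 0"
    and t: "\<And>i. tensor_lift (\<lambda>a b. a \<otimes> L i b) t = (0 :: 'a::complex_vector \<otimes> 'c)"
  shows "t = 0"
proof (rule tensor_eq_0_if_slices_left, rule sep)
  fix \<phi> :: "'a \<Rightarrow> complex" and i assume \<phi>: "linear_functional \<phi>"
  have bil: "cbilinear (\<lambda>a b. (a::'a) \<otimes> L i b)"
    using bilinear_pair[OF clinear_id lin] .
  have "L i (slice_left \<phi> t) = slice_left \<phi> (tensor_lift (\<lambda>a b. a \<otimes> L i b) t)"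
    by (rule clinear_tensor_eqI[where t = t])
      (simp_all add: clinear_comp[OF lin slice_left(1)[OF \<phi>]]
        clinear_comp[OF slice_left(1)[OF \<phi>] clinear_tensor_lift[OF bil]]
        slice_left[OF \<phi>] tensor_lift_of[OF bil] clinear_scaleC[OF lin])
  then show "L i (slice_left \<phi> t) = 0" by (simp add: t clinear_0[OF slice_left(1)[OF \<phi>]])
qed

lemma tensor_eq_0_if_right_factor:
  fixes L :: "'i \<Rightarrow> 'a::complex_vector \<Rightarrow> 'c::complex_vector"
  assumes lin: "\<And>i. clinear (L i)" and sep: "\<And>a. (\<And>i. L i a = 0) \<Longrightarrow> a = 0"
    and t: "\<And>i. tensor_lift (\<lambda>a b. L i a \<otimes> b) t = (0 :: 'c \<otimes> 'b::complex_vector)"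
  shows "t = 0"
proof (rule tensor_eq_0_if_slices_right, rule sep)
  fix \<phi> :: "'b \<Rightarrow> complex" and i assume \<phi>: "linear_functional \<phi>"
  have bil: "cbilinear (\<lambda>a b. L i a \<otimes> (b::'b))"
    using bilinear_pair[OF lin clinear_id] .
  have "L i (slice_right \<phi> t) = slice_right \<phi> (tensor_lift (\<lambda>a b. L i a \<otimes> b) t)"
    by (rule clinear_tensor_eqI[where t = t])
      (simp_all add: clinear_comp[OF lin slice_right(1)[OF \<phi>]]
        clinear_comp[OF slice_right(1)[OF \<phi>] clinear_tensor_lift[OF bil]]
        slice_right[OF \<phi>] tensor_lift_of[OF bil] clinear_scaleC[OF lin])
  then show "L i (slice_right \<phi> t) = 0" by (simp add: t clinear_0[OF slice_right(1)[OF \<phi>]])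
qed

lemma clinear_mult:
  "clinear (\<lambda>x. x * (a::'a::complex_algebra))" "clinear (\<lambda>x. (a::'a::complex_algebra) * x)"
  by (auto intro!: clinearI simp: distrib_left distrib_right mult_scaleC_left mult_scaleC_right)

text \<open>If \<open>t(c \<otimes> d) = 0\<close> for all \<open>c\<close> and \<open>d\<close>, remove \<open>d\<close> in the second leg and then \<open>c\<close> in the
  first one; each step only uses non-degeneracy of one factor.\<close>

instance tensor :: (nondegenerate_algebra, nondegenerate_algebra) nondegenerate_algebra
proof
  fix t :: "'a \<otimes> 'b"
  show "t = 0" if t: "\<And>s. t * s = 0"
  proof (rule tensor_eq_0_if_right_factor[of "\<lambda>c x. x * c"])
    fix c :: 'a
    note bil = bilinear_pair[OF clinear_mult(1) clinear_id, of c]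
    show "tensor_lift (\<lambda>a b. (a * c) \<otimes> b) t = 0"
    proof (rule tensor_eq_0_if_left_factor[of "\<lambda>d x. x * d"])
      fix d :: 'b
      note bil' = bilinear_pair[OF clinear_id clinear_mult(1), of d]
      have "tensor_lift (\<lambda>a b. a \<otimes> (b * d)) (tensor_lift (\<lambda>a b. (a * c) \<otimes> b) t) = t * (c \<otimes> d)"
        by (rule clinear_tensor_eqI[where t = t])
          (simp_all add: clinear_comp[OF clinear_tensor_lift[OF bil'] clinear_tensor_lift[OF bil]]
            clinear_mult tensor_lift_of[OF bil] tensor_lift_of[OF bil'] tensor_mult_of)
      then show "tensor_lift (\<lambda>a b. a \<otimes> (b * d)) (tensor_lift (\<lambda>a b. (a * c) \<otimes> b) t) = 0"
        by (simp add: t)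
    qed (auto intro: clinear_mult nondegenerate_left)
  qed (auto intro: clinear_mult nondegenerate_left)
  show "t = 0" if t: "\<And>s. s * t = 0"
  proof (rule tensor_eq_0_if_right_factor[of "\<lambda>c x. c * x"])
    fix c :: 'a
    note bil = bilinear_pair[OF clinear_mult(2) clinear_id, of c]
    show "tensor_lift (\<lambda>a b. (c * a) \<otimes> b) t = 0"
    proof (rule tensor_eq_0_if_left_factor[of "\<lambda>d x. d * x"])
      fix d :: 'b
      note bil' = bilinear_pair[OF clinear_id clinear_mult(2), of d]
      have "tensor_lift (\<lambda>a b. a \<otimes> (d * b)) (tensor_lift (\<lambda>a b. (c * a) \<otimes> b) t) = (c \<otimes> d) * t"
        by (rule clinear_tensor_eqI[where t = t])
          (simp_all add: clinear_comp[OF clinear_tensor_lift[OF bil'] clinear_tensor_lift[OF bil]]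
            clinear_mult tensor_lift_of[OF bil] tensor_lift_of[OF bil'] tensor_mult_of)
      then show "tensor_lift (\<lambda>a b. a \<otimes> (d * b)) (tensor_lift (\<lambda>a b. (c * a) \<otimes> b) t) = 0"
        by (simp add: t)
    qed (auto intro: clinear_mult nondegenerate_right)
  qed (auto intro: clinear_mult nondegenerate_right)
qed


section \<open>Extending non-degenerate homomorphisms to multipliers\<close>

text \<open>In a non-degenerate algebra the left action determines the right one, because
  \<open>(am)b = a(mb)\<close> for all \<open>b\<close>.\<close>

lemma multiplier_eq_lactI:
  fixes m n :: "'a::nondegenerate_algebra multiplier"
  assumes "\<And>a. lact m a = lact n a"
  shows "m = n"
proof (rule multiplier_eqI[OF assms])
  fix a
  have "(ract a m - ract a n) * b = 0" for b
    using assms[of b] by (simp add: left_diff_distrib flip: multiplier_assoc_act(3))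
  from nondegenerate_left[OF this] show "ract a m = ract a n" by simp
qed

lemma inj_mult_of: "inj (mult_of :: 'a::nondegenerate_algebra \<Rightarrow> 'a multiplier)"
proof (rule injI)
  fix x y :: 'a assume "mult_of x = mult_of y"
  then have "(x - y) * b = 0" for b
    by (metis mult_of_act(1) left_diff_distrib cancel_comm_monoid_add_class.diff_cancel)
  from nondegenerate_left[OF this] show "x = y" by simp
qed

lemma clinear_eq_on_span:
  assumes "clinear f" "clinear g" "cspan S = UNIV" "\<And>x. x \<in> S \<Longrightarrow> f x = g x"
  shows "f x = g x"
proof -
  have "x \<in> cspan S" by (simp add: assms(3))
  then show ?thesis
    by (induction rule: complex_vector.span_induct_alt)
      (simp_all add: assms(4) clinear_simps[OF assms(1)] clinear_simps[OF assms(2)])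
qed

lemma algebra_homD:
  assumes "algebra_hom f"
  shows "clinear f" "f (a * b) = f a * f b"
  using assms by (simp_all add: algebra_hom_def)

lemma nondegenerate_homD:
  assumes "nondegenerate_hom \<alpha>"
  shows "algebra_hom \<alpha>" "cspan {lact (\<alpha> a) b | a b. True} = UNIV"
    "cspan {ract b (\<alpha> a) | a b. True} = UNIV"
  using assms by (simp_all add: nondegenerate_hom_def)

text \<open>The uniqueness principle behind \<open>multiplier_ext\<close>: a multiplier of \<open>B\<close> is determined by its
  action on \<open>\<alpha>(A)B = B\<close>.\<close>

lemma nondegenerate_hom_cancel:
  fixes \<alpha> :: "'a::complex_algebra \<Rightarrow> 'b::nondegenerate_algebra multiplier"
  assumes "nondegenerate_hom \<alpha>" "\<And>a. m * \<alpha> a = n * \<alpha> a"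
  shows "m = n"
proof (rule multiplier_eq_lactI)
  fix b
  show "lact m b = lact n b"
  proof (rule clinear_eq_on_span[where f = "lact m" and g = "lact n"
        and S = "{lact (\<alpha> a) b | a b. True}"])
    fix x assume "x \<in> {lact (\<alpha> a) b | a b. True}"
    then show "lact m x = lact n x"
      using assms(2) by (auto simp flip: multiplier_act(13))
  qed (rule clinear_lact nondegenerate_homD[OF assms(1)])+
qed

lemma nondegenerate_hom_separates:
  fixes \<alpha> :: "'a::complex_algebra \<Rightarrow> 'b::nondegenerate_algebra multiplier"
  assumes "nondegenerate_hom \<alpha>"
  shows "(\<And>a. lact (\<alpha> a) x = 0) \<Longrightarrow> x = 0" "(\<And>a. ract x (\<alpha> a) = 0) \<Longrightarrow> x = 0"
proof -
  have zero: "clinear (\<lambda>_ :: 'b. 0 :: 'b)" by (rule clinearI) simp_all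
  show "x = 0" if x: "\<And>a. lact (\<alpha> a) x = 0"
  proof (rule nondegenerate_right)
    fix b
    show "b * x = 0"
    proof (rule clinear_eq_on_span[where f = "\<lambda>b. b * x" and g = "\<lambda>_. 0"
          and S = "{ract b (\<alpha> a) | a b. True}"])
      fix b assume "b \<in> {ract b (\<alpha> a) | a b. True}"
      then show "b * x = 0" by (auto simp: x simp flip: multiplier_assoc_act(3))
    qed (rule clinear_mult zero nondegenerate_homD[OF assms])+
  qed
  show "x = 0" if x: "\<And>a. ract x (\<alpha> a) = 0"
  proof (rule nondegenerate_left)
    fix b
    show "x * b = 0"
    proof (rule clinear_eq_on_span[where f = "\<lambda>b. x * b" and g = "\<lambda>_. 0"
          and S = "{lact (\<alpha> a) b | a b. True}"])
      fix b assume "b \<in> {lact (\<alpha> a) b | a b. True}"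
      then show "x * b = 0" by (auto simp: x multiplier_assoc_act(3))
    qed (rule clinear_mult zero nondegenerate_homD[OF assms])+
  qed
qed

text \<open>The induced map on the quotient by the kernel of \<open>\<mu>\<close>, realised with a set-theoretic section of
  \<open>\<mu>\<close>.\<close>

lemma linear_factor:
  assumes \<mu>: "clinear \<mu>" and \<nu>: "clinear \<nu>" and surj: "cspan (range \<mu>) = UNIV"
    and ker: "\<And>t. \<mu> t = 0 \<Longrightarrow> \<nu> t = 0"
  obtains L where "clinear L" "\<And>t. L (\<mu> t) = \<nu> t" "surj \<mu>"
proof
  have "x \<in> range \<mu>" if "x \<in> cspan (range \<mu>)" for x
    using that
  proof (induction rule: complex_vector.span_induct_alt)
    case base
    show ?case using clinear_0[OF \<mu>] by (metis rangeI)
  next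
    case (step c x y)
    then show ?case by (auto simp flip: clinear_scaleC[OF \<mu>] clinear_add[OF \<mu>])
  qed
  then show surj': "surj \<mu>" using surj by auto
  show L: "\<nu> (inv \<mu> (\<mu> t)) = \<nu> t" for t
  proof -
    have "\<mu> (inv \<mu> (\<mu> t) - t) = 0"
      by (simp add: clinear_diff[OF \<mu>] surj_f_inv_f[OF surj'])
    from ker[OF this] show ?thesis by (simp add: clinear_diff[OF \<nu>])
  qed
  show "clinear (\<lambda>x. \<nu> (inv \<mu> x))"
  proof (rule clinearI)
    fix x y c
    obtain s t where "x = \<mu> s" "y = \<mu> t" using surj' by (metis surjD)
    then show "\<nu> (inv \<mu> (x + y)) = \<nu> (inv \<mu> x) + \<nu> (inv \<mu> y)"
      "\<nu> (inv \<mu> (c *\<^sub>C x)) = c *\<^sub>C \<nu> (inv \<mu> x)"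
      by (simp_all only: L clinear_add[OF \<mu>, symmetric] clinear_scaleC[OF \<mu>, symmetric])
        (simp_all only: clinear_add[OF \<nu>] clinear_scaleC[OF \<nu>])
  qed
qed

text \<open>The extension must satisfy \<open>n(\<alpha>(a)b) = \<alpha>(ma)b\<close> and \<open>(b\<alpha>(a))n = b\<alpha>(am)\<close>. As \<open>\<alpha>(A)B = B = B\<alpha>(A)\<close>,
  this prescribes both actions once it is consistent. Consistency holds because
  \<open>\<alpha>(c) \<Sum>\<^sub>i \<alpha>(ma\<^sub>i)b\<^sub>i = \<alpha>(cm) \<Sum>\<^sub>i \<alpha>(a\<^sub>i)b\<^sub>i\<close> for all \<open>c\<close>, and elements of \<open>\<alpha>(A)\<close> separate the
  points of \<open>B\<close>. The maps \<open>\<mu>\<close> and \<open>\<nu>\<close> below send \<open>a \<otimes> b\<close> to \<open>\<alpha>(a)b\<close> and \<open>\<alpha>(ma)b\<close>, so that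
  consistency says that \<open>\<nu>\<close> factors through \<open>\<mu>\<close>.\<close>

lemma multiplier_ext_ex:
  fixes \<alpha> :: "'a::complex_algebra \<Rightarrow> 'b::nondegenerate_algebra multiplier"
  assumes \<alpha>: "nondegenerate_hom \<alpha>"
  shows "\<exists>n. \<forall>a. n * \<alpha> a = \<alpha> (lact m a)"
proof -
  note lin = clinear_simps[OF algebra_homD(1)[OF nondegenerate_homD(1)[OF \<alpha>]]]
  note hom = algebra_homD(2)[OF nondegenerate_homD(1)[OF \<alpha>]]
  define \<mu> where "\<mu> = tensor_lift (\<lambda>a b. lact (\<alpha> a) b)"
  define \<nu> where "\<nu> = tensor_lift (\<lambda>a b. lact (\<alpha> (lact m a)) b)"
  define \<mu>' where "\<mu>' = tensor_lift (\<lambda>a b. ract b (\<alpha> a))"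
  define \<nu>' where "\<nu>' = tensor_lift (\<lambda>a b. ract b (\<alpha> (ract a m)))"
  have bil: "cbilinear (\<lambda>a b. lact (\<alpha> a) b)" "cbilinear (\<lambda>a b. lact (\<alpha> (lact m a)) b)"
    "cbilinear (\<lambda>a b. ract b (\<alpha> a))" "cbilinear (\<lambda>a b. ract b (\<alpha> (ract a m)))"
    unfolding cbilinear_def by (auto intro!: clinearI simp: act_simps lin)
  have of: "\<mu> (a \<otimes> b) = lact (\<alpha> a) b" "\<nu> (a \<otimes> b) = lact (\<alpha> (lact m a)) b"
    "\<mu>' (a \<otimes> b) = ract b (\<alpha> a)" "\<nu>' (a \<otimes> b) = ract b (\<alpha> (ract a m))" for a b
    by (simp_all add: \<mu>_def \<nu>_def \<mu>'_def \<nu>'_def tensor_lift_of bil)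
  have clin: "clinear \<mu>" "clinear \<nu>" "clinear \<mu>'" "clinear \<nu>'"
    by (simp_all add: \<mu>_def \<nu>_def \<mu>'_def \<nu>'_def clinear_tensor_lift bil)
  note simps = of clin[THEN clinear_add] clin[THEN clinear_scaleC]
  have "lact (\<alpha> c) (\<nu> t) = lact (\<alpha> (ract c m)) (\<mu> t)" for c t
    by (induction t rule: tensor_induct)
      (simp_all add: simps act_simps multiplier_assoc_act(3) flip: multiplier_act(13) hom)
  then have ker: "\<mu> t = 0 \<Longrightarrow> \<nu> t = 0" for t
    using nondegenerate_hom_separates(1)[OF \<alpha>, of "\<nu> t"] by (simp add: act_simps)
  have "ract (\<nu>' t) (\<alpha> c) = ract (\<mu>' t) (\<alpha> (lact m c))" for c t
    by (induction t rule: tensor_induct)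
      (simp_all add: simps act_simps multiplier_assoc_act(3) flip: multiplier_act(14) hom)
  then have ker': "\<mu>' t = 0 \<Longrightarrow> \<nu>' t = 0" for t
    using nondegenerate_hom_separates(2)[OF \<alpha>, of "\<nu>' t"] by (simp add: act_simps)
  have sub: "{lact (\<alpha> a) b | a b. True} \<subseteq> range \<mu>" "{ract b (\<alpha> a) | a b. True} \<subseteq> range \<mu>'"
    using of(1,3)[symmetric] by auto
  have sp: "cspan (range \<mu>) = UNIV" "cspan (range \<mu>') = UNIV"
    using sub[THEN complex_vector.span_mono] nondegenerate_homD(2,3)[OF \<alpha>] by auto
  obtain L where L: "clinear L" "\<And>t. L (\<mu> t) = \<nu> t" and s: "surj \<mu>"
    using linear_factor[OF clin(1,2) sp(1) ker] by blast
  obtain R where R: "clinear R" "\<And>t. R (\<mu>' t) = \<nu>' t" and s': "surj \<mu>'"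
    using linear_factor[OF clin(3,4) sp(2) ker'] by blast
  \<comment> \<open>Both sides equal \<open>b\<alpha>(am a')c\<close> on \<open>s = a \<otimes> b\<close> and \<open>t = a' \<otimes> c\<close>; this is \<open>x(ny) = (xn)y\<close>.\<close>
  have cross: "\<mu>' s * \<nu> t = \<nu>' s * \<mu> t" for s t
  proof (induction s rule: tensor_induct)
    case (of a b)
    show ?case
      by (induction t rule: tensor_induct)
        (simp_all add: simps distrib_left flip: multiplier_assoc_act(3) multiplier_act(13) hom)
  qed (simp add: simps distrib_right)
  have Lof: "L (lact (\<alpha> a) b) = lact (\<alpha> (lact m a)) b"
    and Rof: "R (ract b (\<alpha> a)) = ract b (\<alpha> (ract a m))" for a b
    using L(2)[of "a \<otimes> b"] R(2)[of "a \<otimes> b"] by (simp_all only: of)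
  have Lm: "L (\<mu> t * b) = \<nu> t * b" for t b
    by (induction t rule: tensor_induct)
      (simp_all add: simps distrib_right clinear_add[OF L(1)]
        Lof flip: multiplier_assoc_act(1))
  have Rm: "R (b * \<mu>' t) = b * \<nu>' t" for t b
    by (induction t rule: tensor_induct)
      (simp_all add: simps distrib_left clinear_add[OF R(1)]
        Rof flip: multiplier_assoc_act(2))
  have "double_centralizer L R"
    by (rule double_centralizerI[OF L(1) R(1)])
      (metis s s' surjD L(2) R(2) Lm, metis s s' surjD L(2) R(2) Rm, metis s s' surjD L(2) R(2) cross)
  then have "lact (Abs_multiplier (L, R)) b = L b" for b
    by (simp add: lact.rep_eq Abs_multiplier_inverse)
  then have "Abs_multiplier (L, R) * \<alpha> a = \<alpha> (lact m a)" for a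
    by (intro multiplier_eq_lactI) (simp add: multiplier_act Lof)
  then show ?thesis by blast
qed

text \<open>Cancelling \<open>\<alpha>(a)\<close> in \<open>\<beta>(m)\<alpha>(a) = \<alpha>(ma)\<close> yields at once that \<open>\<beta>\<close> is a unital homomorphism,
  that it extends \<open>\<alpha>\<close>, and that any other extension equals it. The description of \<open>\<beta>\<close> by \<open>THE\<close>
  in \<open>multiplier_ext\<close> is thereby justified.\<close>

lemma multiplier_ext_unique:
  fixes \<alpha> :: "'a::complex_algebra \<Rightarrow> 'b::nondegenerate_algebra multiplier"
  assumes \<alpha>: "nondegenerate_hom \<alpha>"
  shows "\<exists>!\<beta>. algebra_hom \<beta> \<and> \<beta> 1 = 1 \<and> (\<forall>a. \<beta> (mult_of a) = \<alpha> a)"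
proof -
  note lin = clinear_simps[OF algebra_homD(1)[OF nondegenerate_homD(1)[OF \<alpha>]]]
  note hom = algebra_homD(2)[OF nondegenerate_homD(1)[OF \<alpha>]]
  note cancel = nondegenerate_hom_cancel[OF \<alpha>]
  obtain \<beta> where \<beta>: "\<And>m a. \<beta> m * \<alpha> a = \<alpha> (lact m a)"
    using multiplier_ext_ex[OF \<alpha>] by metis
  show ?thesis
  proof (rule ex1I[of _ \<beta>])
    have "clinear \<beta>"
      by (rule clinearI; rule cancel)
        (simp_all add: \<beta> multiplier_act lin distrib_right mult_scaleC_left)
    moreover have "\<beta> (m * n) = \<beta> m * \<beta> n" for m n
      by (rule cancel) (simp add: \<beta> multiplier_act mult.assoc)
    moreover have "\<beta> 1 = 1"
      by (rule cancel) (simp add: \<beta> multiplier_act)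
    moreover have "\<beta> (mult_of a) = \<alpha> a" for a
      by (rule cancel) (simp add: \<beta> hom)
    ultimately show "algebra_hom \<beta> \<and> \<beta> 1 = 1 \<and> (\<forall>a. \<beta> (mult_of a) = \<alpha> a)"
      by (simp add: algebra_hom_def)
  next
    fix \<beta>' assume *: "algebra_hom \<beta>' \<and> \<beta>' 1 = 1 \<and> (\<forall>a. \<beta>' (mult_of a) = \<alpha> a)"
    have "\<beta>' m * \<alpha> a = \<alpha> (lact m a)" for m a
      using * by (metis algebra_homD(2) multiplier_times_mult_of)
    then have "\<beta>' m = \<beta> m" for m
      by (intro cancel[of "\<beta>' m" "\<beta> m"]) (simp add: \<beta>)
    then show "\<beta>' = \<beta>" by blast
  qed
qed

text \<open>These two rules are all that is used about the extension; by
  \<open>nondegenerate_hom_cancel\<close> the first of them characterises it.\<close>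

lemma multiplier_ext_act:
  fixes \<alpha> :: "'a::complex_algebra \<Rightarrow> 'b::nondegenerate_algebra multiplier"
  assumes "nondegenerate_hom \<alpha>"
  shows "multiplier_ext \<alpha> m * \<alpha> a = \<alpha> (lact m a)" "\<alpha> a * multiplier_ext \<alpha> m = \<alpha> (ract a m)"
proof -
  have "algebra_hom (multiplier_ext \<alpha>)" "\<And>a. multiplier_ext \<alpha> (mult_of a) = \<alpha> a"
    using theI'[OF multiplier_ext_unique[OF assms]] by (simp_all add: multiplier_ext_def)
  then show "multiplier_ext \<alpha> m * \<alpha> a = \<alpha> (lact m a)"
    "\<alpha> a * multiplier_ext \<alpha> m = \<alpha> (ract a m)"
    by (metis algebra_homD(2) multiplier_times_mult_of mult_of_times_multiplier)+
qed

lemma hom_tensor_of: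
  assumes "clinear \<alpha>" "clinear \<beta>"
  shows "clinear (hom_tensor \<alpha> \<beta>)" "hom_tensor \<alpha> \<beta> (a \<otimes> b) = mtensor (\<alpha> a) (\<beta> b)"
proof -
  have "cbilinear (\<lambda>a b. mtensor (\<alpha> a) (\<beta> b))"
    unfolding cbilinear_def
    by (auto intro!: clinearI simp: cbilinear_simps[OF bilinear_mtensor]
        clinear_simps[OF assms(1)] clinear_simps[OF assms(2)])
  then show "clinear (hom_tensor \<alpha> \<beta>)" "hom_tensor \<alpha> \<beta> (a \<otimes> b) = mtensor (\<alpha> a) (\<beta> b)"
    unfolding hom_tensor_def by (rule clinear_tensor_lift, rule tensor_lift_of)
qed

lemma cspan_closed:
  "0 \<in> cspan S" "x \<in> cspan S \<Longrightarrow> y \<in> cspan S \<Longrightarrow> x + y \<in> cspan S"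
  "x \<in> cspan S \<Longrightarrow> c *\<^sub>C x \<in> cspan S" "x \<in> S \<Longrightarrow> x \<in> cspan S"
  by (rule complex_vector.span_zero complex_vector.span_add complex_vector.span_scale
      complex_vector.span_base; assumption)+

lemma tensor_of_in_cspan:
  assumes "a \<in> cspan S" "b \<in> cspan T"
  shows "a \<otimes> b \<in> cspan {a \<otimes> b | a b. a \<in> S \<and> b \<in> T}"
  using assms(1)
proof (induction rule: complex_vector.span_induct_alt)
  case (step c a a')
  have "a \<otimes> b \<in> cspan {a \<otimes> b | a b. a \<in> S \<and> b \<in> T}" using assms(2)
  proof (induction rule: complex_vector.span_induct_alt)
    case (step d b b')
    have "a \<otimes> b \<in> cspan {a \<otimes> b | a b. a \<in> S \<and> b \<in> T}"
      using step \<open>a \<in> S\<close> by (blast intro: cspan_closed(4))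
    then show ?case using step(2)
      by (simp only: tensor_of_add_right tensor_of_scaleC_right cspan_closed(2,3))
  qed (simp add: cspan_closed)
  then show ?case using step
    by (simp add: tensor_of_add_left tensor_of_scaleC_left cspan_closed)
qed (simp add: cspan_closed)

lemma cspan_tensors_UNIV:
  assumes "cspan S = UNIV" "cspan T = UNIV" "\<And>a b. a \<in> S \<Longrightarrow> b \<in> T \<Longrightarrow> a \<otimes> b \<in> cspan W"
  shows "cspan W = UNIV"
proof -
  have "cspan {a \<otimes> b | a b. a \<in> S \<and> b \<in> T} \<subseteq> cspan W"
    by (rule complex_vector.span_minimal) (use assms(3) in \<open>auto simp: complex_vector.subspace_span\<close>)
  then have "a \<otimes> b \<in> cspan W" for a b
    using tensor_of_in_cspan[of a S b T] assms(1,2) by auto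
  then have "t \<in> cspan W" for t
    by (induction t rule: tensor_induct) (simp_all add: cspan_closed)
  then show ?thesis by blast
qed

lemma nondegenerate_hom_tensor:
  assumes "nondegenerate_hom \<alpha>" "nondegenerate_hom \<beta>"
  shows "nondegenerate_hom (hom_tensor \<alpha> \<beta>)"
proof -
  note hom = assms[THEN nondegenerate_homD(1)]
  note clin = hom[THEN algebra_homD(1)]
  note ht = hom_tensor_of[OF clin]
  have "hom_tensor \<alpha> \<beta> (s * t) = hom_tensor \<alpha> \<beta> s * hom_tensor \<alpha> \<beta> t" for s t
  proof (induction s rule: tensor_induct)
    case (of a b)
    show ?case
      by (induction t rule: tensor_induct)
        (simp_all add: ht(2) clinear_add[OF ht(1)] distrib_left tensor_mult_of mtensor_mult
          algebra_homD(2)[OF hom(1)] algebra_homD(2)[OF hom(2)])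
  qed (simp add: clinear_add[OF ht(1)] distrib_right)
  moreover have "cspan {lact (hom_tensor \<alpha> \<beta> s) t | s t. True} = UNIV"
  proof (rule cspan_tensors_UNIV[OF assms[THEN nondegenerate_homD(2)]], rule cspan_closed(4))
    fix x y
    assume "x \<in> {lact (\<alpha> a) b | a b. True}" "y \<in> {lact (\<beta> a) b | a b. True}"
    then obtain a b c d where "x = lact (\<alpha> a) b" "y = lact (\<beta> c) d" by blast
    then have "x \<otimes> y = lact (hom_tensor \<alpha> \<beta> (a \<otimes> c)) (b \<otimes> d)" by (simp add: ht)
    then show "x \<otimes> y \<in> {lact (hom_tensor \<alpha> \<beta> s) t | s t. True}" by blast
  qed
  moreover have "cspan {ract t (hom_tensor \<alpha> \<beta> s) | s t. True} = UNIV"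
  proof (rule cspan_tensors_UNIV[OF assms[THEN nondegenerate_homD(3)]], rule cspan_closed(4))
    fix x y
    assume "x \<in> {ract b (\<alpha> a) | a b. True}" "y \<in> {ract b (\<beta> a) | a b. True}"
    then obtain a b c d where "x = ract b (\<alpha> a)" "y = ract d (\<beta> c)" by blast
    then have "x \<otimes> y = ract (b \<otimes> d) (hom_tensor \<alpha> \<beta> (a \<otimes> c))" by (simp add: ht)
    then show "x \<otimes> y \<in> {ract t (hom_tensor \<alpha> \<beta> s) | s t. True}" by blast
  qed
  ultimately show ?thesis
    using ht(1) by (simp add: nondegenerate_hom_def algebra_hom_def)
qed


section \<open>The coproduct is non-degenerate\<close>

lemma multiplier_hopf_algebraD:
  assumes "multiplier_hopf_algebra \<Delta>"
  shows "algebra_hom \<Delta>"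
    and "\<Delta> a * mtensor 1 (mult_of b) \<in> range mult_of"
    and "mtensor (mult_of a) 1 * \<Delta> b \<in> range mult_of"
    and "mult_of ` UNIV = range (tensor_lift (\<lambda>a b. \<Delta> a * mtensor 1 (mult_of b)))"
    and "mult_of ` UNIV = range (tensor_lift (\<lambda>a b. mtensor (mult_of a) 1 * \<Delta> b))"
  using assms unfolding multiplier_hopf_algebra_def bij_betw_def by blast+

lemma bilinear_coproduct_maps:
  assumes "clinear \<Delta>"
  shows "cbilinear (\<lambda>a b. \<Delta> a * mtensor 1 (mult_of b))"
    and "cbilinear (\<lambda>a b. mtensor (mult_of a) 1 * \<Delta> b)"
  unfolding cbilinear_def
  by (auto intro!: clinearI simp: clinear_simps[OF assms] clinear_simps[OF clinear_mult_of]
      cbilinear_simps[OF bilinear_mtensor] distrib_left distrib_right mult_scaleC_left mult_scaleC_right)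

text \<open>Both canonical maps together force \<open>A\<^sup>2 = A\<close>. Suppose that \<open>\<phi> \<noteq> 0\<close> is a functional
  vanishing on \<open>A\<^sup>2\<close> and put \<open>u = (a \<otimes> 1)\<Delta>(b)\<close>. Then \<open>u(1 \<otimes> c) = (a \<otimes> 1)(\<Delta>(b)(1 \<otimes> c))\<close> lies in
  \<open>A\<^sup>2 \<otimes> A\<close>, so \<open>(\<phi> \<otimes> \<iota>)(u)c = 0\<close> for all \<open>c\<close>, and \<open>(\<phi> \<otimes> \<iota>)(u) = 0\<close>. Since such \<open>u\<close> span
  \<open>A \<otimes> A\<close>, the map \<open>\<phi> \<otimes> \<iota>\<close> vanishes, which is impossible.\<close>

lemma multiplier_hopf_algebra_idempotent:
  fixes \<Delta> :: "'a::nondegenerate_algebra \<Rightarrow> ('a \<otimes> 'a) multiplier"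
  assumes \<Delta>: "multiplier_hopf_algebra \<Delta>"
  shows "cspan {a * b :: 'a | a b. True} = UNIV"
proof (rule ccontr)
  assume "cspan {a * b :: 'a | a b. True} \<noteq> UNIV"
  then obtain x where x: "x \<notin> cspan {a * b :: 'a | a b. True}" by blast
  obtain \<phi> where \<phi>: "linear_functional \<phi>" "\<phi> x = 1"
    and "\<And>y. y \<in> cspan {a * b :: 'a | a b. True} \<Longrightarrow> \<phi> y = 0"
    using separating_functional[OF complex_vector.subspace_span x] by metis
  then have \<phi>0: "\<phi> (a * b) = 0" for a b by (blast intro: cspan_closed(4))
  note slice = slice_left[OF \<phi>(1)]
  note bil = bilinear_coproduct_maps(2)[OF algebra_homD(1)[OF multiplier_hopf_algebraD(1)[OF \<Delta>]]]
  have slice0: "slice_left \<phi> u = 0" if u: "mtensor (mult_of a) 1 * \<Delta> b = mult_of u" for a b u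
  proof (rule nondegenerate_left)
    fix c
    obtain v where v: "\<Delta> b * mtensor 1 (mult_of c) = mult_of v"
      using multiplier_hopf_algebraD(2)[OF \<Delta>] by blast
    have "mult_of (ract u (mtensor 1 (mult_of c))) = mult_of (lact (mtensor (mult_of a) 1) v)"
      by (simp flip: mult_of_times_multiplier multiplier_times_mult_of u v add: mult.assoc)
    then have "ract u (mtensor 1 (mult_of c)) = lact (mtensor (mult_of a) 1) v"
      by (rule injD[OF inj_mult_of])
    moreover have "slice_left \<phi> (ract u (mtensor 1 (mult_of c))) = slice_left \<phi> u * c"
      by (induction u rule: tensor_induct)
        (simp_all add: act_simps slice clinear_add[OF slice(1)] distrib_right mult_scaleC_left)
    moreover have "slice_left \<phi> (lact (mtensor (mult_of a) 1) v) = 0"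
      by (induction v rule: tensor_induct)
        (simp_all add: act_simps slice clinear_add[OF slice(1)] \<phi>0)
    ultimately show "slice_left \<phi> u * c = 0" by simp
  qed
  let ?T2 = "tensor_lift (\<lambda>a b. mtensor (mult_of a) 1 * \<Delta> b)"
  have image: "\<exists>u. ?T2 t = mult_of u \<and> slice_left \<phi> u = 0" for t
  proof (induction t rule: tensor_induct)
    case (add s t)
    then obtain u v where "?T2 s = mult_of u" "slice_left \<phi> u = 0"
      "?T2 t = mult_of v" "slice_left \<phi> v = 0" by blast
    then show ?case
      by (intro exI[of _ "u + v"])
        (simp add: clinear_add[OF clinear_tensor_lift[OF bil]] clinear_add[OF clinear_mult_of]
          clinear_add[OF slice(1)])
  next
    case (of a b)
    show ?case
      using slice0[of a b] multiplier_hopf_algebraD(3)[OF \<Delta>, of a b]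
      by (auto simp: tensor_lift_of[OF bil])
  qed
  have "slice_left \<phi> u = 0" for u :: "'a \<otimes> 'a"
  proof -
    obtain t where "mult_of u = ?T2 t" using multiplier_hopf_algebraD(5)[OF \<Delta>] by blast
    then show ?thesis using image[of t] by (metis injD[OF inj_mult_of])
  qed
  then have "x = 0" using slice(2)[of x x] \<phi>(2) by (simp add: scaleC_one)
  then show False using x cspan_closed(1) by blast
qed

text \<open>From \<open>\<Delta>(A)(1 \<otimes> A) = A \<otimes> A\<close> one gets \<open>\<Delta>(A)(A \<otimes> A) = (A \<otimes> A)(A \<otimes> 1) = A\<^sup>2 \<otimes> A = A \<otimes> A\<close>, and
  symmetrically on the other side.\<close>

lemma multiplier_hopf_algebra_nondegenerate:
  fixes \<Delta> :: "'a::nondegenerate_algebra \<Rightarrow> ('a \<otimes> 'a) multiplier"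
  assumes \<Delta>: "multiplier_hopf_algebra \<Delta>"
  shows "nondegenerate_hom \<Delta>"
proof -
  note idem = multiplier_hopf_algebra_idempotent[OF \<Delta>]
  note D = multiplier_hopf_algebraD[OF \<Delta>]
  note bil = bilinear_coproduct_maps[OF algebra_homD(1)[OF D(1)]]
  have UNIV: "cspan (UNIV :: 'a set) = UNIV" by (rule complex_vector.span_UNIV)
  have "cspan {lact (\<Delta> a) t | a t. True} = UNIV" (is "cspan ?W = _")
  proof (rule cspan_tensors_UNIV[OF idem UNIV])
    fix z y :: 'a assume "z \<in> {a * b | a b. True}"
    then obtain x c where z: "z = x * c" by blast
    obtain t where t: "mult_of (x \<otimes> y) = tensor_lift (\<lambda>a b. \<Delta> a * mtensor 1 (mult_of b)) t"
      using D(4) by blast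
    have "tensor_lift (\<lambda>a b. \<Delta> a * mtensor 1 (mult_of b)) t * mtensor (mult_of c) 1
      \<in> mult_of ` cspan ?W" for t
    proof (induction t rule: tensor_induct)
      case (add s t)
      then show ?case
        by (auto simp: clinear_add[OF clinear_tensor_lift[OF bil(1)]] distrib_right
            simp flip: clinear_add[OF clinear_mult_of] intro: cspan_closed)
    next
      case (of a b)
      have "\<Delta> a * mtensor 1 (mult_of b) * mtensor (mult_of c) 1 = mult_of (lact (\<Delta> a) (c \<otimes> b))"
        by (simp add: mult.assoc mtensor_mult mtensor_mult_of multiplier_times_mult_of
            multiplier_act)
      then show ?case by (auto simp: tensor_lift_of[OF bil(1)] intro: cspan_closed)
    qed
    from this[of t] have "mult_of (z \<otimes> y) \<in> mult_of ` cspan ?W"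
      by (simp add: z mult_of_times_multiplier multiplier_act flip: t)
    then show "z \<otimes> y \<in> cspan ?W" by (simp add: inj_image_mem_iff[OF inj_mult_of])
  qed
  moreover have "cspan {ract t (\<Delta> a) | a t. True} = UNIV" (is "cspan ?W = _")
  proof (rule cspan_tensors_UNIV[OF UNIV idem])
    fix x z :: 'a assume "z \<in> {a * b | a b. True}"
    then obtain c y where z: "z = c * y" by blast
    obtain t where t: "mult_of (x \<otimes> y) = tensor_lift (\<lambda>a b. mtensor (mult_of a) 1 * \<Delta> b) t"
      using D(5) by blast
    have "mtensor 1 (mult_of c) * tensor_lift (\<lambda>a b. mtensor (mult_of a) 1 * \<Delta> b) t
      \<in> mult_of ` cspan ?W" for t
    proof (induction t rule: tensor_induct)
      case (add s t)
      then show ?case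
        by (auto simp: clinear_add[OF clinear_tensor_lift[OF bil(2)]] distrib_left
            simp flip: clinear_add[OF clinear_mult_of] intro: cspan_closed)
    next
      case (of a b)
      have "mtensor 1 (mult_of c) * (mtensor (mult_of a) 1 * \<Delta> b) = mult_of (ract (a \<otimes> c) (\<Delta> b))"
        by (simp add: mtensor_mult mtensor_mult_of mult_of_times_multiplier
            multiplier_act flip: mult.assoc)
      then show ?case by (auto simp: tensor_lift_of[OF bil(2)] intro: cspan_closed)
    qed
    from this[of t] have "mult_of (x \<otimes> z) \<in> mult_of ` cspan ?W"
      by (simp add: z multiplier_times_mult_of multiplier_act flip: t)
    then show "x \<otimes> z \<in> cspan ?W" by (simp add: inj_image_mem_iff[OF inj_mult_of])
  qed
  ultimately show ?thesis using D(1) by (simp add: nondegenerate_hom_def)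
qed


section \<open>Central partitions of unity and gradings\<close>

text \<open>Commuting with \<open>A\<close> is enough for being central in \<open>M(A)\<close>: if \<open>cm = mc\<close> for all \<open>c \<in> A\<close>,
  then \<open>c(m(na)) = m((cn)a) = (cn)(ma) = c(n(ma))\<close>.\<close>

lemma central_multiplier_iff:
  fixes m :: "'a::nondegenerate_algebra multiplier"
  shows "m \<in> centre \<longleftrightarrow> (\<forall>a. ract a m = lact m a)"
proof
  assume m: "m \<in> centre"
  show "\<forall>a. ract a m = lact m a"
  proof
    fix a
    have "mult_of a * m = m * mult_of a" using m by (simp add: centre_def)
    then show "ract a m = lact m a"
      by (simp add: mult_of_times_multiplier multiplier_times_mult_of inj_eq[OF inj_mult_of])
  qed
next
  assume m: "\<forall>a. ract a m = lact m a"
  have "m * n = n * m" for n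
  proof (rule multiplier_eq_lactI)
    fix a
    have mid: "c * lact m x = lact m (c * x)" for c x
      using m by (simp add: multiplier_assoc_act)
    have "c * (lact m (lact n a) - lact n (lact m a)) = 0" for c
    proof -
      have "c * lact m (lact n a) = lact m (ract c n * a)"
        by (simp only: mid multiplier_assoc_act(3)[of c n])
      also have "\<dots> = c * lact n (lact m a)"
        by (simp only: multiplier_assoc_act(3)[of c n] mid)
      finally show ?thesis by (simp add: right_diff_distrib)
    qed
    from nondegenerate_right[OF this] show "lact (m * n) a = lact (n * m) a"
      by (simp add: multiplier_act)
  qed
  then show "m \<in> centre" by (simp add: centre_def)
qed

lemma centre_closed:
  "x \<in> centre \<Longrightarrow> y \<in> centre \<Longrightarrow> x + y \<in> centre" "x \<in> centre \<Longrightarrow> c *\<^sub>C x \<in> centre" "0 \<in> centre"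
  by (simp_all add: centre_def distrib_left distrib_right mult_scaleC_left mult_scaleC_right)

lemma central_mtensor:
  fixes m :: "'a::nondegenerate_algebra multiplier" and n :: "'b::nondegenerate_algebra multiplier"
  assumes "m \<in> centre" "n \<in> centre"
  shows "mtensor m n \<in> centre"
  unfolding central_multiplier_iff
proof
  fix t
  show "ract t (mtensor m n) = lact (mtensor m n) t"
    by (induction t rule: tensor_induct)
      (use assms in \<open>simp_all add: act_simps central_multiplier_iff\<close>)
qed

lemma one_in_centre: "1 \<in> (centre :: 'a::complex_algebra multiplier set)"
  by (simp add: centre_def)

text \<open>A family of central orthogonal idempotents of \<open>M(A)\<close> that sum up to \<open>1\<close> strictly: the third clause
  says that \<open>A\<close> is the span of the ideals \<open>\<pi>\<^sub>pA\<close>. Such families mediate between the two sides of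
  the equivalence. They are the values on the point masses of a non-degenerate central
  homomorphism \<open>K(G) \<rightarrow> M(A)\<close>, and they are the projections of a decomposition of \<open>A\<close> into a
  direct sum of subalgebras that annihilate each other.\<close>

definition central_partition :: "('k \<Rightarrow> 'a::complex_algebra multiplier) \<Rightarrow> bool"
  where "central_partition \<pi> \<longleftrightarrow> (\<forall>p. \<pi> p \<in> centre) \<and>
    (\<forall>p q. \<pi> p * \<pi> q = (if p = q then \<pi> p else 0)) \<and>
    cspan (\<Union>p. range (lact (\<pi> p))) = UNIV"

lemma central_partitionD:
  assumes "central_partition \<pi>"
  shows "\<pi> p \<in> centre" "\<pi> p * \<pi> q = (if p = q then \<pi> p else 0)"
    "cspan (\<Union>p. range (lact (\<pi> p))) = UNIV"
    "lact (\<pi> p) (lact (\<pi> q) a) = (if p = q then lact (\<pi> p) a else 0)"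
proof -
  show 1: "\<pi> p \<in> centre" "\<pi> p * \<pi> q = (if p = q then \<pi> p else 0)"
    "cspan (\<Union>p. range (lact (\<pi> p))) = UNIV"
    using assms by (simp_all add: central_partition_def)
  show "lact (\<pi> p) (lact (\<pi> q) a) = (if p = q then lact (\<pi> p) a else 0)"
    by (simp add: 1(2) multiplier_act(1) flip: multiplier_act(13))
qed

lemma central_partition_of_hom:
  assumes "nondegenerate_hom \<gamma>" "range \<gamma> \<subseteq> centre"
  shows "central_partition (\<lambda>p. \<gamma> (delta p))"
proof -
  note lin = clinear_simps[OF algebra_homD(1)[OF nondegenerate_homD(1)[OF assms(1)]]]
  note hom = algebra_homD(2)[OF nondegenerate_homD(1)[OF assms(1)]]
  have "lact (\<gamma> f) b \<in> cspan (\<Union>p. range (lact (\<gamma> (delta p))))" for f b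
    by (induction f rule: finsupp_induct) (auto simp: lin act_simps intro: cspan_closed)
  then have "cspan {lact (\<gamma> f) b | f b. True} \<subseteq> cspan (\<Union>p. range (lact (\<gamma> (delta p))))"
    by (intro complex_vector.span_minimal) (auto simp: complex_vector.subspace_span)
  then have "cspan (\<Union>p. range (lact (\<gamma> (delta p)))) = UNIV"
    using nondegenerate_homD(2)[OF assms(1)] by auto
  then show ?thesis
    using assms(2) by (auto simp: central_partition_def delta_mult lin simp flip: hom)
qed

text \<open>A linear map on \<open>K(G)\<close> is recovered from its values on the point masses, so passing from a
  homomorphism to its partition loses nothing.\<close>

lemma finsupp_lift_hom:
  assumes "clinear \<gamma>"
  shows "finsupp_lift (\<lambda>p. \<gamma> (delta p)) = \<gamma>"
  by (rule ext, rule clinear_finsupp_eqI) (simp_all add: assms clinear_finsupp_lift)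

lemma fun_of_simps [simp]:
  "fun_of (x + y) k = fun_of x k + fun_of y k" "fun_of (c *\<^sub>C x) k = c * fun_of x k"
  "fun_of 0 k = 0" "fun_of (delta j) k = (if k = j then 1 else 0)"
  by (simp_all add: plus_finsupp.rep_eq scaleC_finsupp.rep_eq zero_finsupp.rep_eq delta.rep_eq)

lemma finsupp_lift_partition_mult:
  assumes "central_partition \<pi>"
  shows "finsupp_lift \<pi> f * \<pi> p = fun_of f p *\<^sub>C \<pi> p"
  by (induction f rule: finsupp_induct)
    (simp_all add: clinear_simps[OF clinear_finsupp_lift] distrib_right mult_scaleC_left
      scaleC_add_left scaleC_scaleC scaleC_one central_partitionD[OF assms])

lemma finsupp_lift_partition_act:
  assumes "central_partition \<pi>" "a \<in> range (lact (\<pi> p))"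
  shows "lact (finsupp_lift \<pi> f) a = fun_of f p *\<^sub>C a"
proof -
  obtain b where "a = lact (\<pi> p) b" using assms(2) by blast
  then show ?thesis
    by (simp add: finsupp_lift_partition_mult[OF assms(1)] multiplier_act(11)
        flip: multiplier_act(13))
qed

lemma hom_of_central_partition:
  fixes \<pi> :: "'k \<Rightarrow> 'a::nondegenerate_algebra multiplier"
  assumes \<pi>: "central_partition \<pi>"
  shows "nondegenerate_hom (finsupp_lift \<pi>)" "range (finsupp_lift \<pi>) \<subseteq> centre"
    "(\<And>p. \<pi> p \<noteq> 0) \<Longrightarrow> inj (finsupp_lift \<pi>)"
proof -
  let ?\<gamma> = "finsupp_lift \<pi>"
  note lin = clinear_simps[OF clinear_finsupp_lift]
  have central: "?\<gamma> f \<in> centre" for f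
    by (induction f rule: finsupp_induct)
      (simp_all add: lin centre_closed central_partitionD[OF \<pi>])
  then show "range ?\<gamma> \<subseteq> centre" by blast
  have "?\<gamma> (f * delta p) = ?\<gamma> f * ?\<gamma> (delta p)" for f p
    by (induction f rule: finsupp_induct)
      (simp_all add: lin distrib_right mult_scaleC_left delta_mult central_partitionD[OF \<pi>])
  then have "?\<gamma> (f * g) = ?\<gamma> f * ?\<gamma> g" for f g
    by (induction g rule: finsupp_induct) (simp_all add: lin distrib_left mult_scaleC_right)
  then have "algebra_hom ?\<gamma>"
    by (simp add: algebra_hom_def clinear_finsupp_lift)
  moreover have "(\<Union>p. range (lact (\<pi> p))) \<subseteq> {lact (?\<gamma> f) b | f b. True}"
    by (auto, metis finsupp_lift_delta)
  then have "cspan {lact (?\<gamma> f) b | f b. True} = UNIV"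
    using complex_vector.span_mono central_partitionD(3)[OF \<pi>] by blast
  moreover have "ract b (?\<gamma> f) = lact (?\<gamma> f) b" for b f
    using central central_multiplier_iff by blast
  ultimately show "nondegenerate_hom ?\<gamma>" by (simp add: nondegenerate_hom_def)
  show "inj ?\<gamma>" if nz: "\<And>p. \<pi> p \<noteq> 0"
  proof (rule injI)
    fix f g assume "?\<gamma> f = ?\<gamma> g"
    then have eq: "fun_of f p *\<^sub>C \<pi> p = fun_of g p *\<^sub>C \<pi> p" for p
      by (metis finsupp_lift_partition_mult[OF \<pi>])
    have "fun_of f p = fun_of g p" for p
      using eq[of p] nz[of p] by (simp add: complex_vector.scale_cancel_right)
    then show "f = g" by (metis fun_of_inject ext)
  qed
qed

text \<open>Although the partition may be infinite, each element meets only finitely many components.\<close>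

lemma central_partition_finite_sum:
  assumes \<pi>: "central_partition \<pi>"
  obtains F where "finite F" "a = (\<Sum>p\<in>F. lact (\<pi> p) a)" "\<And>p. p \<notin> F \<Longrightarrow> lact (\<pi> p) a = 0"
proof -
  note lin = clinear_simps[OF clinear_lact]
  have "\<exists>F. finite F \<and> a = (\<Sum>p\<in>F. lact (\<pi> p) a) \<and> (\<forall>p. p \<notin> F \<longrightarrow> lact (\<pi> p) a = 0)"
    if "a \<in> cspan (\<Union>p. range (lact (\<pi> p)))"
    using that
  proof (induction rule: complex_vector.span_induct_alt)
    case base
    show ?case by (auto simp: lin)
  next
    case (step c x y)
    then obtain F q z where F: "finite F" "y = (\<Sum>p\<in>F. lact (\<pi> p) y)"
      "\<forall>p. p \<notin> F \<longrightarrow> lact (\<pi> p) y = 0" and x: "x = lact (\<pi> q) z" by blast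
    have act: "lact (\<pi> p) x = (if p = q then x else 0)" for p
      by (simp add: x central_partitionD[OF \<pi>])
    have "(\<Sum>p\<in>insert q F. lact (\<pi> p) (c *\<^sub>C x + y)) =
        c *\<^sub>C (\<Sum>p\<in>insert q F. lact (\<pi> p) x) + (\<Sum>p\<in>insert q F. lact (\<pi> p) y)"
      by (simp only: lin sum.distrib complex_vector.scale_sum_right)
    also have "(\<Sum>p\<in>insert q F. lact (\<pi> p) x) = x" using F(1) by (simp add: act)
    also have "(\<Sum>p\<in>insert q F. lact (\<pi> p) y) = y"
      using F by (cases "q \<in> F") (simp_all add: insert_absorb)
    finally show ?case using F
      by (intro exI[of _ "insert q F"]) (auto simp: lin act)
  qed
  then show thesis using that by (auto simp: central_partitionD[OF \<pi>])
qed

lemma lact_sum: "lact m (sum f S) = (\<Sum>i\<in>S. lact m (f i))"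
  by (induction S rule: infinite_finite_induct) (simp_all add: act_simps)

text \<open>Components are recovered by \<open>\<pi>\<^sub>q(\<Sum>\<^sub>p a\<^sub>p) = a\<^sub>q\<close>, which gives uniqueness of the decomposition;
  products of different components vanish because \<open>(\<pi>\<^sub>pa)(\<pi>\<^sub>qb) = \<pi>\<^sub>p\<pi>\<^sub>q(ab)\<close>.\<close>

lemma central_partition_grading:
  fixes \<pi> :: "'k \<Rightarrow> 'a::nondegenerate_algebra multiplier"
  assumes \<pi>: "central_partition \<pi>"
  shows "direct_sum_decomposition (\<lambda>p. range (lact (\<pi> p)))"
    and "subalgebra (range (lact (\<pi> p)))"
    and "p \<noteq> q \<Longrightarrow> a \<in> range (lact (\<pi> p)) \<Longrightarrow> b \<in> range (lact (\<pi> q)) \<Longrightarrow> a * b = 0"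
proof -
  note lin = clinear_simps[OF clinear_lact]
  note \<pi>D = central_partitionD[OF \<pi>]
  have comm: "a * lact (\<pi> p) b = lact (\<pi> p) (a * b)" for p a b
    using \<pi>D(1)[of p] by (simp add: multiplier_assoc_act central_multiplier_iff)
  show "subalgebra (range (lact (\<pi> p)))"
    unfolding subalgebra_def complex_vector.subspace_def
  proof (intro conjI ballI allI)
    show "0 \<in> range (lact (\<pi> p))" using lin(4) by (metis rangeI)
  next
    fix x y c assume "x \<in> range (lact (\<pi> p))" "y \<in> range (lact (\<pi> p))"
    then obtain a b where x: "x = lact (\<pi> p) a" "y = lact (\<pi> p) b" by blast
    show "x + y \<in> range (lact (\<pi> p))" "c *\<^sub>C x \<in> range (lact (\<pi> p))"
      unfolding x by (simp_all only: lin(1,5)[symmetric] rangeI)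
    show "x * y \<in> range (lact (\<pi> p))" unfolding x comm by (rule rangeI)
  qed
  show "a * b = 0" if "p \<noteq> q" "a \<in> range (lact (\<pi> p))" "b \<in> range (lact (\<pi> q))"
    using that by (auto simp: comm \<pi>D simp flip: multiplier_assoc_act(1))
  show "direct_sum_decomposition (\<lambda>p. range (lact (\<pi> p)))"
    unfolding direct_sum_decomposition_def
  proof (intro allI ex1I)
    fix a
    obtain F where F: "finite F" "a = (\<Sum>p\<in>F. lact (\<pi> p) a)" "\<And>p. p \<notin> F \<Longrightarrow> lact (\<pi> p) a = 0"
      using central_partition_finite_sum[OF \<pi>] by blast
    have "{p. lact (\<pi> p) a \<noteq> 0} \<subseteq> F" using F(3) by blast
    moreover from this have "(\<Sum>p | lact (\<pi> p) a \<noteq> 0. lact (\<pi> p) a) = (\<Sum>p\<in>F. lact (\<pi> p) a)"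
      by (intro sum.mono_neutral_left F(1)) auto
    moreover from calculation have "finite {p. lact (\<pi> p) a \<noteq> 0}"
      using F(1) by (blast intro: finite_subset)
    ultimately show "finite {p. lact (\<pi> p) a \<noteq> 0} \<and> (\<forall>p. lact (\<pi> p) a \<in> range (lact (\<pi> p))) \<and>
        a = (\<Sum>p | lact (\<pi> p) a \<noteq> 0. lact (\<pi> p) a)"
      using F(2) by (metis rangeI)
  next
    fix a f
    assume f: "finite {p. f p \<noteq> 0} \<and> (\<forall>p. f p \<in> range (lact (\<pi> p))) \<and> a = (\<Sum>p | f p \<noteq> 0. f p)"
    then have act: "lact (\<pi> q) (f p) = (if p = q then f p else 0)" for p q
      by (metis \<pi>D(4) rangeE)
    show "f = (\<lambda>p. lact (\<pi> p) a)"
    proof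
      fix q
      have "lact (\<pi> q) a = (\<Sum>p | f p \<noteq> 0. lact (\<pi> q) (f p))"
        using f lact_sum[of "\<pi> q" f "{p. f p \<noteq> 0}"] by simp
      also have "\<dots> = f q" using f by (simp add: act)
      finally show "f q = lact (\<pi> q) a" ..
    qed
  qed
qed

text \<open>Uniqueness of the decomposition makes the component maps linear: sums and multiples of
  decompositions are decompositions.\<close>

lemma direct_sum_projections:
  fixes A :: "'k \<Rightarrow> 'a::complex_vector set"
  assumes ds: "direct_sum_decomposition A" and sub: "\<And>p. csubspace (A p)"
  obtains P where "\<And>p. clinear (P p)" "\<And>p a. P p a \<in> A p"
    "\<And>p q a. a \<in> A q \<Longrightarrow> P p a = (if p = q then a else 0)"
    "cspan (\<Union>p. A p) = UNIV"
proof -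
  define ok where "ok a f \<longleftrightarrow> finite {p. f p \<noteq> 0} \<and> (\<forall>p. f p \<in> A p) \<and> a = (\<Sum>p | f p \<noteq> 0. f p)"
    for a f
  have "\<forall>a. \<exists>!f. ok a f" using ds by (simp add: direct_sum_decomposition_def ok_def)
  then obtain c where c: "\<And>a. ok a (c a)" and uniq: "\<And>a f. ok a f \<Longrightarrow> f = c a" by metis
  note subs = complex_vector.subspace_0[OF sub] complex_vector.subspace_add[OF sub]
    complex_vector.subspace_scale[OF sub]
  \<comment> \<open>Sums over any finite set containing the support will do, which is convenient for adding.\<close>
  have okI: "ok a f" if "finite F" "\<And>p. p \<notin> F \<Longrightarrow> f p = 0" "\<And>p. f p \<in> A p" "a = sum f F" for a f F
  proof -
    have "{p. f p \<noteq> 0} \<subseteq> F" using that(2) by blast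
    moreover from this have "(\<Sum>p | f p \<noteq> 0. f p) = sum f F"
      by (intro sum.mono_neutral_left that(1)) auto
    ultimately show ?thesis
      unfolding ok_def using that finite_subset by auto
  qed
  have superset: "a = sum (c a) F" if "finite F" "{p. c a p \<noteq> 0} \<subseteq> F" for a F
  proof -
    have "(\<Sum>p | c a p \<noteq> 0. c a p) = sum (c a) F"
      by (rule sum.mono_neutral_left) (use that in auto)
    then show ?thesis using c[of a] by (simp add: ok_def)
  qed
  have fin: "finite {p. c a p \<noteq> 0}" "c a p \<in> A p" for a p using c by (auto simp: ok_def)
  have lin: "clinear (\<lambda>a. c a p)" for p
  proof (rule clinearI)
    fix x y :: 'a and s
    let ?F = "{p. c x p \<noteq> 0} \<union> {p. c y p \<noteq> 0}"
    have "ok (x + y) (\<lambda>p. c x p + c y p)"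
      by (rule okI[of ?F]) (auto simp: fin subs sum.distrib simp flip: superset)
    from fun_cong[OF uniq[OF this], of p] show "c (x + y) p = c x p + c y p" by simp
    have "ok (s *\<^sub>C x) (\<lambda>p. s *\<^sub>C c x p)"
      by (rule okI[of "{p. c x p \<noteq> 0}"])
        (auto simp: fin subs simp flip: superset complex_vector.scale_sum_right)
    from fun_cong[OF uniq[OF this], of p] show "c (s *\<^sub>C x) p = s *\<^sub>C c x p" by simp
  qed
  have homogeneous: "c a p = (if p = q then a else 0)" if "a \<in> A q" for a p q
  proof -
    have "ok a (\<lambda>p. if p = q then a else 0)"
      by (rule okI[of "{q}"]) (auto simp: that subs)
    from fun_cong[OF uniq[OF this], of p] show ?thesis by simp
  qed
  have span: "a \<in> cspan (\<Union>p. A p)" for a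
  proof -
    have "c a p \<in> cspan (\<Union>p. A p)" for p
      by (rule complex_vector.span_base) (use fin(2) in blast)
    then have "sum (c a) {p. c a p \<noteq> 0} \<in> cspan (\<Union>p. A p)"
      by (rule complex_vector.span_sum)
    then show ?thesis by (simp only: superset[OF fin(1) subset_refl, symmetric])
  qed
  show thesis
    by (rule that[of "\<lambda>p a. c a p", OF lin fin(2) homogeneous]) (use span in blast)+
qed

text \<open>The projection \<open>P\<^sub>p\<close> onto \<open>A\<^sub>p\<close> satisfies \<open>P\<^sub>p(ab) = P\<^sub>p(a)b = aP\<^sub>p(b)\<close>. By linearity this need only be
  verified for homogeneous \<open>a\<close> and \<open>b\<close>, where it follows from \<open>A\<^sub>rA\<^sub>s = 0\<close> for \<open>r \<noteq> s\<close> and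
  \<open>A\<^sub>rA\<^sub>r \<subseteq> A\<^sub>r\<close>. So \<open>(P\<^sub>p, P\<^sub>p)\<close> is a multiplier, and it is central because its two actions
  agree.\<close>

lemma central_partition_of_grading:
  fixes A :: "'k \<Rightarrow> 'a::nondegenerate_algebra set"
  assumes ds: "direct_sum_decomposition A" and sub: "\<And>p. subalgebra (A p)"
    and orth: "\<And>p q a b. p \<noteq> q \<Longrightarrow> a \<in> A p \<Longrightarrow> b \<in> A q \<Longrightarrow> a * b = 0"
  obtains \<pi> where "central_partition \<pi>" "\<And>p. A p = range (lact (\<pi> p))"
proof -
  have "csubspace (A p)" for p using sub[of p] by (simp add: subalgebra_def)
  from direct_sum_projections[OF ds this]
  obtain P where lin: "\<And>p. clinear (P p)" and P: "\<And>p a. P p a \<in> A p"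
    "\<And>p q a. a \<in> A q \<Longrightarrow> P p a = (if p = q then a else 0)" and span: "cspan (\<Union>p. A p) = UNIV"
    by metis
  have bimodule: "P p (a * b) = P p a * b \<and> P p (a * b) = a * P p b" for p a b
  proof -
    have hom: "P p (a * b) = P p a * b \<and> P p (a * b) = a * P p b"
      if "a \<in> A r" "b \<in> A s" for a b r s
    proof (cases "r = s")
      case True
      then have "a * b \<in> A r" using that sub[of r] by (auto simp: subalgebra_def)
      then show ?thesis using True that by (simp add: P)
    next
      case False
      then show ?thesis using that orth[OF False] by (simp add: P clinear_0[OF lin])
    qed
    have hom': "P p (a * b) = P p a * b \<and> P p (a * b) = a * P p b" if a: "a \<in> A r" for a b r
    proof
      show "P p (a * b) = P p a * b"
        by (rule clinear_eq_on_span[OF _ _ span, of "\<lambda>b. P p (a * b)" "\<lambda>b. P p a * b"])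
          (use hom[OF a] in \<open>auto simp: clinear_mult clinear_comp[OF lin clinear_mult(2)]\<close>)
      show "P p (a * b) = a * P p b"
        by (rule clinear_eq_on_span[OF _ _ span, of "\<lambda>b. P p (a * b)" "\<lambda>b. a * P p b"])
          (use hom[OF a] in \<open>auto simp: clinear_comp[OF clinear_mult(2) lin]
             clinear_comp[OF lin clinear_mult(2)]\<close>)
    qed
    show ?thesis
    proof
      show "P p (a * b) = P p a * b"
        by (rule clinear_eq_on_span[OF _ _ span, of "\<lambda>a. P p (a * b)" "\<lambda>a. P p a * b"])
          (use hom' in \<open>auto simp: clinear_comp[OF clinear_mult(1) lin]
             clinear_comp[OF lin clinear_mult(1)]\<close>)
      show "P p (a * b) = a * P p b"
        by (rule clinear_eq_on_span[OF _ _ span, of "\<lambda>a. P p (a * b)" "\<lambda>a. a * P p b"])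
          (use hom' in \<open>auto simp: clinear_mult clinear_comp[OF lin clinear_mult(1)]\<close>)
    qed
  qed
  define \<pi> where "\<pi> p = Abs_multiplier (P p, P p)" for p
  have "double_centralizer (P p) (P p)" for p
    using bimodule by (intro double_centralizerI lin) metis+
  then have act: "lact (\<pi> p) = P p" "ract a (\<pi> p) = P p a" for p a
    by (auto simp: \<pi>_def fun_eq_iff lact.rep_eq ract.rep_eq Abs_multiplier_inverse)
  have A: "A p = range (lact (\<pi> p))" for p
    using P by (auto simp: act) (metis rangeI)
  have "\<pi> p \<in> centre" for p by (simp add: central_multiplier_iff act)
  moreover have "\<pi> p * \<pi> q = (if p = q then \<pi> p else 0)" for p q
    by (rule multiplier_eq_lactI) (simp add: multiplier_act act P(2)[OF P(1)])
  ultimately have "central_partition \<pi>"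
    using span by (simp add: central_partition_def A)
  then show thesis using that A by blast
qed


section \<open>The coproduct on a graded algebra\<close>

lemma mtensor_zero [simp]: "mtensor 0 n = 0" "mtensor m 0 = 0"
  using cbilinear_simps(3)[OF bilinear_mtensor, of 0 0 n]
    cbilinear_simps(4)[OF bilinear_mtensor, of m 0 0] by simp_all

lemma mtensor_partition_mult:
  assumes "central_partition \<pi>" "central_partition \<rho>"
  shows "mtensor (\<pi> p) (\<rho> q) * mtensor (\<pi> r) (\<rho> s) =
    (if p = r \<and> q = s then mtensor (\<pi> p) (\<rho> q) else 0)"
  by (simp add: mtensor_mult central_partitionD(2)[OF assms(1)] central_partitionD(2)[OF assms(2)])

lemma lact_comult_K:
  "lact (comult_K f) (delta p \<otimes> delta q) = fun_of f (p + q) *\<^sub>C (delta p \<otimes> delta q)"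
  by (simp add: lact.rep_eq comult_K_def function_multiplier.rep_eq pointwise_mult_delta)

text \<open>The multipliers \<open>\<pi>\<^sub>p \<otimes> \<pi>\<^sub>q\<close> are the image of the point masses under the non-degenerate map
  \<open>\<gamma> \<otimes> \<gamma>\<close>, so identities in \<open>M(A \<otimes> A)\<close> may be tested on them.\<close>

lemma multiplier_eqI_partition:
  fixes m n :: "('a::nondegenerate_algebra \<otimes> 'a) multiplier"
  assumes \<pi>: "central_partition \<pi>"
    and eq: "\<And>p q. m * mtensor (\<pi> p) (\<pi> q) = n * mtensor (\<pi> p) (\<pi> q)"
  shows "m = n"
proof (rule nondegenerate_hom_cancel)
  let ?\<gamma> = "finsupp_lift \<pi>"
  show "nondegenerate_hom (hom_tensor ?\<gamma> ?\<gamma>)"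
    by (intro nondegenerate_hom_tensor hom_of_central_partition \<pi>)
  note ht = hom_tensor_of[OF clinear_finsupp_lift clinear_finsupp_lift]
  show "m * hom_tensor ?\<gamma> ?\<gamma> t = n * hom_tensor ?\<gamma> ?\<gamma> t" for t
    by (induction t rule: tensor_delta_induct)
      (simp_all add: clinear_simps[OF ht(1)] ht(2) distrib_left mult_scaleC_right eq)
qed

text \<open>The idempotent \<open>\<pi>\<^sub>p \<otimes> \<pi>\<^sub>q\<close> is the image of \<open>\<delta>\<^sub>p \<otimes> \<delta>\<^sub>q\<close>, which \<open>\<Delta>\<^sub>G(f)\<close> multiplies by \<open>f(pq)\<close>.
  By \<open>multiplier_eqI_partition\<close> these products determine the extended multiplier.\<close>

lemma comult_K_ext_mult:
  fixes \<pi> :: "'g::group_add \<Rightarrow> 'a::nondegenerate_algebra multiplier"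
  assumes \<pi>: "central_partition \<pi>" and \<gamma>: "\<gamma> = finsupp_lift \<pi>"
  shows "multiplier_ext (hom_tensor \<gamma> \<gamma>) (comult_K f) * mtensor (\<pi> p) (\<pi> q) =
    fun_of f (p + q) *\<^sub>C mtensor (\<pi> p) (\<pi> q)"
proof -
  have nd: "nondegenerate_hom (hom_tensor \<gamma> \<gamma>)"
    unfolding \<gamma> by (intro nondegenerate_hom_tensor hom_of_central_partition \<pi>)
  have "clinear \<gamma>" unfolding \<gamma> by (rule clinear_finsupp_lift)
  note ht = hom_tensor_of[OF this this]
  have "mtensor (\<pi> p) (\<pi> q) = hom_tensor \<gamma> \<gamma> (delta p \<otimes> delta q)"
    by (simp add: ht, simp add: \<gamma>)
  then show ?thesis
    by (simp add: multiplier_ext_act(1)[OF nd] lact_comult_K clinear_scaleC[OF ht(1)])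
qed

text \<open>Formally \<open>E = \<Sum> \<pi>\<^sub>r \<otimes> \<pi>\<^sub>s\<close> over \<open>rs = pq\<close>. Fixing \<open>s = q\<close> or \<open>r = p\<close> leaves the single summand
  \<open>\<pi>\<^sub>p \<otimes> \<pi>\<^sub>q\<close>, by cancellation in the group.\<close>

lemma comult_K_ext_delta:
  fixes \<pi> :: "'g::group_add \<Rightarrow> 'a::nondegenerate_algebra multiplier" and p q :: 'g
  assumes \<pi>: "central_partition \<pi>" and \<gamma>: "\<gamma> = finsupp_lift \<pi>"
  defines "E \<equiv> multiplier_ext (hom_tensor \<gamma> \<gamma>) (comult_K (delta (p + q)))"
  shows "E * mtensor 1 (\<pi> q) = mtensor (\<pi> p) (\<pi> q)"
    and "E * mtensor (\<pi> p) 1 = mtensor (\<pi> p) (\<pi> q)"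
proof -
  show "E * mtensor 1 (\<pi> q) = mtensor (\<pi> p) (\<pi> q)"
  proof (rule multiplier_eqI_partition[OF \<pi>])
    fix r s
    have "E * mtensor 1 (\<pi> q) * mtensor (\<pi> r) (\<pi> s) =
        (if q = s then E * mtensor (\<pi> r) (\<pi> s) else 0)"
      by (simp add: mult.assoc mtensor_mult central_partitionD(2)[OF \<pi>])
    then show "E * mtensor 1 (\<pi> q) * mtensor (\<pi> r) (\<pi> s) =
        mtensor (\<pi> p) (\<pi> q) * mtensor (\<pi> r) (\<pi> s)"
      by (auto simp: E_def comult_K_ext_mult[OF \<pi> \<gamma>] mtensor_partition_mult[OF \<pi> \<pi>] scaleC_one)
  qed
  show "E * mtensor (\<pi> p) 1 = mtensor (\<pi> p) (\<pi> q)"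
  proof (rule multiplier_eqI_partition[OF \<pi>])
    fix r s
    have "E * mtensor (\<pi> p) 1 * mtensor (\<pi> r) (\<pi> s) =
        (if p = r then E * mtensor (\<pi> r) (\<pi> s) else 0)"
      by (simp add: mult.assoc mtensor_mult central_partitionD(2)[OF \<pi>])
    then show "E * mtensor (\<pi> p) 1 * mtensor (\<pi> r) (\<pi> s) =
        mtensor (\<pi> p) (\<pi> q) * mtensor (\<pi> r) (\<pi> s)"
      by (auto simp: E_def comult_K_ext_mult[OF \<pi> \<gamma>] mtensor_partition_mult[OF \<pi> \<pi>] scaleC_one)
  qed
qed

lemma cspan_image:
  assumes "clinear f"
  shows "cspan (f ` S) = f ` cspan S"
  by (rule module_hom.span_image[OF Vector_Spaces.linear.axioms(3)[OF assms]])

lemma cspan_pure_tensors: "cspan {a \<otimes> b | a b. True} = UNIV"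
  by (rule cspan_tensors_UNIV[OF complex_vector.span_UNIV complex_vector.span_UNIV])
    (blast intro: cspan_closed)

lemma cspan_bilinear:
  assumes "cbilinear f"
  shows "cspan {f a b | a b. True} = range (tensor_lift f)"
proof -
  have "{f a b | a b. True} = tensor_lift f ` {a \<otimes> b | a b. True}"
    by (auto simp: tensor_lift_of[OF assms, symmetric])
  then show ?thesis
    by (simp only: cspan_image clinear_tensor_lift assms cspan_pure_tensors)
qed

text \<open>For \<open>m = \<pi>\<^sub>p\<close> and \<open>n = \<pi>\<^sub>q\<close> this turns the right-hand sides of the grading conditions into
  ideals of \<open>A \<otimes> A\<close> cut out by one central idempotent.\<close>

lemma cspan_homogeneous_tensors:
  "cspan {a \<otimes> b | a b. a \<in> range (lact m) \<and> b \<in> range (lact n)} = range (lact (mtensor m n))"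
proof -
  have "{a \<otimes> b | a b. a \<in> range (lact m) \<and> b \<in> range (lact n)} =
      lact (mtensor m n) ` {a \<otimes> b | a b. True}"
    by (simp add: set_eq_iff image_iff) (metis mtensor_act(1))
  then show ?thesis by (simp only: cspan_image clinear_lact cspan_pure_tensors)
qed

text \<open>With \<open>Z = \<pi>\<^sub>p \<otimes> \<pi>\<^sub>q\<close> and \<open>E = \<Delta>(\<pi>\<^sub>p\<^sub>q)\<close>, the coalgebra property turns \<open>\<Delta>(\<pi>\<^sub>p\<^sub>qa)(1 \<otimes> \<pi>\<^sub>qb)\<close> into
  \<open>\<Delta>(a)E(1 \<otimes> \<pi>\<^sub>q)(1 \<otimes> b) = Z\<Delta>(a)(1 \<otimes> b)\<close>. The elements \<open>\<Delta>(a)(1 \<otimes> b)\<close> span \<open>A \<otimes> A\<close>, hence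
  \<open>\<Delta>(A\<^sub>p\<^sub>q)(1 \<otimes> A\<^sub>q) = Z(A \<otimes> A) = A\<^sub>p \<otimes> A\<^sub>q\<close>. The other condition is treated in the same way.\<close>

lemma cograding_of_comultiplicative_partition:
  fixes \<pi> :: "'g::group_add \<Rightarrow> 'a::nondegenerate_algebra multiplier"
  assumes \<Delta>: "multiplier_hopf_algebra \<Delta>" and \<pi>: "central_partition \<pi>"
    and nz: "\<And>p. \<pi> p \<noteq> 0" and \<gamma>: "\<gamma> = finsupp_lift \<pi>"
    and comult: "\<And>f. multiplier_ext \<Delta> (\<gamma> f) = multiplier_ext (hom_tensor \<gamma> \<gamma>) (comult_K f)"
  shows "cograding \<Delta> (\<lambda>p. range (lact (\<pi> p)))"
proof -
  note nd = multiplier_hopf_algebra_nondegenerate[OF \<Delta>]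
  note D = multiplier_hopf_algebraD[OF \<Delta>]
  note bil = bilinear_coproduct_maps[OF algebra_homD(1)[OF D(1)]]
  define Z where "Z p q = mtensor (\<pi> p) (\<pi> q)" for p q
  define E where "E p q = multiplier_ext (hom_tensor \<gamma> \<gamma>) (comult_K (delta (p + q)))" for p q
  have centralD: "z * m = m * z" if "z \<in> centre" for z m :: "('a \<otimes> 'a) multiplier"
    using that by (simp add: centre_def)
  have Zc: "Z p q \<in> centre" "mtensor (\<pi> p) (1 :: 'a multiplier) \<in> centre" for p q
    unfolding Z_def by (intro central_mtensor central_partitionD[OF \<pi>] one_in_centre)+
  note E = comult_K_ext_delta[OF \<pi> \<gamma>, folded E_def Z_def]
  have \<Delta>\<pi>: "\<Delta> (lact (\<pi> (p + q)) a) = \<Delta> a * E p q" for p q a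
  proof -
    have "multiplier_ext \<Delta> (\<pi> (p + q)) = E p q"
      using comult[of "delta (p + q)"] by (simp add: E_def \<gamma>)
    moreover have "ract a (\<pi> (p + q)) = lact (\<pi> (p + q)) a"
      using central_partitionD(1)[OF \<pi>] central_multiplier_iff by blast
    ultimately show ?thesis using multiplier_ext_act(2)[OF nd, of a "\<pi> (p + q)"] by simp
  qed
  have image: "mult_of ` cspan {a \<otimes> b | a b. a \<in> range (lact (\<pi> p)) \<and> b \<in> range (lact (\<pi> q))} =
      (*) (Z p q) ` range mult_of" for p q
    unfolding cspan_homogeneous_tensors
    by (simp add: Z_def image_image multiplier_times_mult_of)
  have first: "cspan {\<Delta> a * mtensor 1 (mult_of b) | a b.
        a \<in> range (lact (\<pi> (p + q))) \<and> b \<in> range (lact (\<pi> q))} = (*) (Z p q) ` range mult_of" for p q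
  proof -
    have "\<Delta> (lact (\<pi> (p + q)) a) * mtensor 1 (mult_of (lact (\<pi> q) b)) =
        Z p q * (\<Delta> a * mtensor 1 (mult_of b))" for a b
    proof -
      have "\<Delta> (lact (\<pi> (p + q)) a) * mtensor 1 (mult_of (lact (\<pi> q) b)) =
          \<Delta> a * (E p q * mtensor 1 (\<pi> q)) * mtensor 1 (mult_of b)"
        by (simp add: \<Delta>\<pi> mult.assoc mtensor_mult multiplier_times_mult_of)
      then show ?thesis by (simp add: E centralD[OF Zc(1)] mult.assoc)
    qed
    then have "{\<Delta> a * mtensor 1 (mult_of b) | a b.
        a \<in> range (lact (\<pi> (p + q))) \<and> b \<in> range (lact (\<pi> q))} =
        (*) (Z p q) ` {\<Delta> a * mtensor 1 (mult_of b) | a b. True}"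
      by (auto simp: image_def) metis+
    then show ?thesis
      by (simp only: cspan_image clinear_mult cspan_bilinear[OF bil(1)] D(4))
  qed
  have second: "cspan {mtensor (mult_of a) 1 * \<Delta> b | a b.
        a \<in> range (lact (\<pi> p)) \<and> b \<in> range (lact (\<pi> (p + q)))} = (*) (Z p q) ` range mult_of" for p q
  proof -
    have "mtensor (mult_of (lact (\<pi> p) a)) 1 * \<Delta> (lact (\<pi> (p + q)) b) =
        Z p q * (mtensor (mult_of a) 1 * \<Delta> b)" for a b
    proof -
      have "mtensor (mult_of (lact (\<pi> p) a)) 1 * \<Delta> (lact (\<pi> (p + q)) b) =
          mtensor (\<pi> p) 1 * (mtensor (mult_of a) 1 * \<Delta> b * E p q)"
        by (simp add: \<Delta>\<pi> mtensor_mult multiplier_times_mult_of flip: mult.assoc)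
      also have "\<dots> = mtensor (mult_of a) 1 * \<Delta> b * (E p q * mtensor (\<pi> p) 1)"
        by (simp add: centralD[OF Zc(2)] mult.assoc)
      finally show ?thesis by (simp add: E centralD[OF Zc(1)])
    qed
    then have "{mtensor (mult_of a) 1 * \<Delta> b | a b.
        a \<in> range (lact (\<pi> p)) \<and> b \<in> range (lact (\<pi> (p + q)))} =
        (*) (Z p q) ` {mtensor (mult_of a) 1 * \<Delta> b | a b. True}"
      by (auto simp: image_def) metis+
    then show ?thesis
      by (simp only: cspan_image clinear_mult cspan_bilinear[OF bil(2)] D(5))
  qed
  have "range (lact (\<pi> p)) \<noteq> {0}" for p
  proof
    assume "range (lact (\<pi> p)) = {0}"
    then have "lact (\<pi> p) a = 0" for a by blast
    then have "\<pi> p = 0" by (intro multiplier_eq_lactI) (simp add: multiplier_act)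
    then show False using nz by simp
  qed
  then show ?thesis
    unfolding cograding_def image first second
    using central_partition_grading(1,2)[OF \<pi>]
    by (intro conjI allI impI ballI central_partition_grading(3)[OF \<pi>]) (assumption | simp)+
qed

text \<open>As \<open>\<Delta>(\<gamma>(f))\<Delta>(a) = \<Delta>(\<gamma>(f)a)\<close>, the multiplier \<open>\<Delta>(\<gamma>(f))\<close> acts as \<open>f(pq)\<close> on \<open>\<Delta>(A\<^sub>p\<^sub>q)(1 \<otimes> A\<^sub>q)\<close>.
  By the grading this space is \<open>A\<^sub>p \<otimes> A\<^sub>q\<close>, on which \<open>(\<gamma> \<otimes> \<gamma>)(\<Delta>\<^sub>G(f))\<close> acts as the same scalar.\<close>

lemma comultiplicative_of_cograding:
  fixes \<pi> :: "'g::group_add \<Rightarrow> 'a::nondegenerate_algebra multiplier"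
  assumes \<Delta>: "multiplier_hopf_algebra \<Delta>" and \<pi>: "central_partition \<pi>" and \<gamma>: "\<gamma> = finsupp_lift \<pi>"
    and cograding: "cograding \<Delta> (\<lambda>p. range (lact (\<pi> p)))"
  shows "multiplier_ext \<Delta> (\<gamma> f) = multiplier_ext (hom_tensor \<gamma> \<gamma>) (comult_K f)"
proof (rule multiplier_eqI_partition[OF \<pi>])
  note nd = multiplier_hopf_algebra_nondegenerate[OF \<Delta>]
  fix p q
  let ?c = "fun_of f (p + q)" and ?m = "multiplier_ext \<Delta> (\<gamma> f)"
  have scalar: "?m * y = ?c *\<^sub>C y"
    if "y \<in> cspan {\<Delta> a * mtensor 1 (mult_of b) | a b.
      a \<in> range (lact (\<pi> (p + q))) \<and> b \<in> range (lact (\<pi> q))}" for y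
    using that
  proof (induction rule: complex_vector.span_induct_alt)
    case (step d x y)
    then obtain a b where x: "x = \<Delta> a * mtensor 1 (mult_of b)" and a: "a \<in> range (lact (\<pi> (p + q)))"
      by blast
    have "?m * \<Delta> a = ?c *\<^sub>C \<Delta> a"
      by (simp add: multiplier_ext_act(1)[OF nd] \<gamma> finsupp_lift_partition_act[OF \<pi> a]
          clinear_scaleC[OF algebra_homD(1)[OF nondegenerate_homD(1)[OF nd]]])
    then have "?m * x = ?c *\<^sub>C x"
      by (simp add: x mult_scaleC_left flip: mult.assoc)
    then show ?case
      by (simp add: step distrib_left mult_scaleC_right scaleC_add_right scaleC_scaleC mult.commute)
  qed simp
  have "?m * mtensor (\<pi> p) (\<pi> q) = ?c *\<^sub>C mtensor (\<pi> p) (\<pi> q)"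
  proof (rule multiplier_eq_lactI)
    fix t
    have "mult_of (lact (mtensor (\<pi> p) (\<pi> q)) t) \<in>
        cspan {\<Delta> a * mtensor 1 (mult_of b) | a b.
          a \<in> range (lact (\<pi> (p + q))) \<and> b \<in> range (lact (\<pi> q))}"
      using cograding unfolding cograding_def cspan_homogeneous_tensors by blast
    from scalar[OF this]
    have "mult_of (lact ?m (lact (mtensor (\<pi> p) (\<pi> q)) t)) =
        mult_of (?c *\<^sub>C lact (mtensor (\<pi> p) (\<pi> q)) t)"
      by (simp add: multiplier_times_mult_of clinear_scaleC[OF clinear_mult_of])
    then show "lact (?m * mtensor (\<pi> p) (\<pi> q)) t = lact (?c *\<^sub>C mtensor (\<pi> p) (\<pi> q)) t"
      by (simp add: multiplier_act inj_eq[OF inj_mult_of])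
  qed
  then show "?m * mtensor (\<pi> p) (\<pi> q) =
      multiplier_ext (hom_tensor \<gamma> \<gamma>) (comult_K f) * mtensor (\<pi> p) (\<pi> q)"
    by (simp add: comult_K_ext_mult[OF \<pi> \<gamma>])
qed

lemma cograding_partition:
  assumes "cograding \<Delta> A"
  obtains \<pi> where "central_partition \<pi>" "\<And>p. A p = range (lact (\<pi> p))" "\<And>p. \<pi> p \<noteq> 0"
proof -
  have A: "direct_sum_decomposition A" "subalgebra (A p)" "A p \<noteq> {0}"
    "p \<noteq> q \<Longrightarrow> a \<in> A p \<Longrightarrow> b \<in> A q \<Longrightarrow> a * b = 0" for p q a b
    using assms unfolding cograding_def by blast+
  obtain \<pi> where \<pi>: "central_partition \<pi>" "\<And>p. A p = range (lact (\<pi> p))"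
    by (rule central_partition_of_grading[of A]) (use A in blast)+
  have "\<pi> p \<noteq> 0" for p
  proof
    assume "\<pi> p = 0"
    then have "A p = {0}" by (simp add: \<pi>(2) multiplier_act(1) image_constant_conv)
    then show False using A(3) by blast
  qed
  with \<pi> show thesis by (rule that)
qed

text \<open>On \<open>A\<^sub>p\<close> one has \<open>\<gamma>(f)\<^sup>*x = (x\<^sup>*\<gamma>(f))\<^sup>* = (f(p)x\<^sup>*)\<^sup>*\<close>, because \<open>x\<^sup>*\<close> is again in \<open>A\<^sub>p\<close>.\<close>

lemma finsupp_lift_star:
  fixes \<pi> :: "'k \<Rightarrow> 'a::nondegenerate_algebra multiplier"
  assumes \<pi>: "central_partition \<pi>" and star: "star_algebra star"
    and inv: "\<And>p. star ` range (lact (\<pi> p)) \<subseteq> range (lact (\<pi> p))"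
  shows "finsupp_lift \<pi> (finsupp_cnj f) = multiplier_star star (finsupp_lift \<pi> f)"
proof (rule multiplier_eq_lactI)
  fix a
  show "lact (finsupp_lift \<pi> (finsupp_cnj f)) a = lact (multiplier_star star (finsupp_lift \<pi> f)) a"
  proof (rule clinear_eq_on_span[OF clinear_lact clinear_lact central_partitionD(3)[OF \<pi>]])
    fix x assume "x \<in> (\<Union>p. range (lact (\<pi> p)))"
    then obtain p where x: "x \<in> range (lact (\<pi> p))" by blast
    then have x': "star x \<in> range (lact (\<pi> p))" using inv by blast
    have "ract (star x) (finsupp_lift \<pi> f) = lact (finsupp_lift \<pi> f) (star x)"
      using hom_of_central_partition(2)[OF \<pi>] central_multiplier_iff by blast
    then have "lact (multiplier_star star (finsupp_lift \<pi> f)) x = star (fun_of f p *\<^sub>C star x)"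
      by (simp add: multiplier_star_act[OF star] finsupp_lift_partition_act[OF \<pi> x'])
    also have "\<dots> = cnj (fun_of f p) *\<^sub>C x" using star by (simp add: star_algebra_def)
    finally show "lact (finsupp_lift \<pi> (finsupp_cnj f)) x =
        lact (multiplier_star star (finsupp_lift \<pi> f)) x"
      by (simp add: finsupp_lift_partition_act[OF \<pi> x] finsupp_cnj.rep_eq)
  qed
qed

theorem theorem1p2:
  fixes \<Delta> :: "'a::nondegenerate_algebra \<Rightarrow> ('a \<otimes> 'a) multiplier"
  assumes "multiplier_hopf_algebra \<Delta>"
  shows "((\<exists>A :: 'g::group_add \<Rightarrow> 'a set. cograding \<Delta> A) \<longleftrightarrow>
      (\<exists>\<gamma> :: 'g finsupp \<Rightarrow> 'a multiplier.
        nondegenerate_hom \<gamma> \<and> inj \<gamma> \<and>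
        range \<gamma> \<subseteq> centre \<and>
        (\<forall>f. multiplier_ext \<Delta> (\<gamma> f) = multiplier_ext (hom_tensor \<gamma> \<gamma>) (comult_K f)))) \<and>
    (\<forall>(star :: 'a \<Rightarrow> 'a) (A :: 'g \<Rightarrow> 'a set).
      multiplier_hopf_star_algebra \<Delta> star \<and> cograding \<Delta> A \<and> (\<forall>p. star ` A p \<subseteq> A p) \<longrightarrow>
      (\<exists>\<gamma> :: 'g finsupp \<Rightarrow> 'a multiplier.
        nondegenerate_hom \<gamma> \<and> inj \<gamma> \<and>
        range \<gamma> \<subseteq> centre \<and>
        (\<forall>f. multiplier_ext \<Delta> (\<gamma> f) = multiplier_ext (hom_tensor \<gamma> \<gamma>) (comult_K f)) \<and>
        (\<forall>f p. \<forall>a\<in>A p. lact (\<gamma> f) a = fun_of f p *\<^sub>C a) \<and>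
        (\<forall>f. \<gamma> (finsupp_cnj f) = multiplier_star star (\<gamma> f))))"
proof -
  have forward: "nondegenerate_hom \<gamma> \<and> inj \<gamma> \<and> range \<gamma> \<subseteq> centre \<and>
      (\<forall>f. multiplier_ext \<Delta> (\<gamma> f) = multiplier_ext (hom_tensor \<gamma> \<gamma>) (comult_K f))"
    if "cograding \<Delta> A" "central_partition \<pi>" "\<And>p. A p = range (lact (\<pi> p))" "\<And>p. \<pi> p \<noteq> 0"
      "\<gamma> = finsupp_lift \<pi>" for A and \<pi> :: "'g \<Rightarrow> 'a multiplier" and \<gamma>
  proof -
    have "A = (\<lambda>p. range (lact (\<pi> p)))" using that(3) by blast
    then show ?thesis
      using hom_of_central_partition[OF that(2)] that(4)
        comultiplicative_of_cograding[OF assms that(2,5)] that(1)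
      by (simp add: that(5))
  qed
  show ?thesis
  proof (intro conjI iffI allI impI)
    assume "\<exists>A :: 'g \<Rightarrow> 'a set. cograding \<Delta> A"
    then obtain A :: "'g \<Rightarrow> 'a set" where A: "cograding \<Delta> A" by blast
    obtain \<pi> where "central_partition \<pi>" "\<And>p. A p = range (lact (\<pi> p))" "\<And>p. \<pi> p \<noteq> 0"
      using cograding_partition[OF A] by metis
    from forward[OF A this refl]
    show "\<exists>\<gamma> :: 'g finsupp \<Rightarrow> 'a multiplier. nondegenerate_hom \<gamma> \<and> inj \<gamma> \<and> range \<gamma> \<subseteq> centre \<and>
      (\<forall>f. multiplier_ext \<Delta> (\<gamma> f) = multiplier_ext (hom_tensor \<gamma> \<gamma>) (comult_K f))"
      by blast
  next
    assume "\<exists>\<gamma> :: 'g finsupp \<Rightarrow> 'a multiplier. nondegenerate_hom \<gamma> \<and> inj \<gamma> \<and> range \<gamma> \<subseteq> centre \<and>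
      (\<forall>f. multiplier_ext \<Delta> (\<gamma> f) = multiplier_ext (hom_tensor \<gamma> \<gamma>) (comult_K f))"
    then obtain \<gamma> :: "'g finsupp \<Rightarrow> 'a multiplier" where \<gamma>: "nondegenerate_hom \<gamma>" "inj \<gamma>"
      "range \<gamma> \<subseteq> centre"
      "\<And>f. multiplier_ext \<Delta> (\<gamma> f) = multiplier_ext (hom_tensor \<gamma> \<gamma>) (comult_K f)"
      by blast
    have lin: "clinear \<gamma>" by (rule algebra_homD(1)[OF nondegenerate_homD(1)[OF \<gamma>(1)]])
    have "\<gamma> (delta p) \<noteq> 0" for p
    proof
      assume "\<gamma> (delta p) = 0"
      then have "delta p = 0" using \<gamma>(2) clinear_0[OF lin] by (metis injD)
      then have "fun_of (delta p) p = 0" by simp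
      then show False by simp
    qed
    from cograding_of_comultiplicative_partition[OF assms central_partition_of_hom[OF \<gamma>(1,3)] this
        finsupp_lift_hom[OF lin, symmetric] \<gamma>(4)]
    show "\<exists>A :: 'g \<Rightarrow> 'a set. cograding \<Delta> A" by blast
  next
    fix star :: "'a \<Rightarrow> 'a" and A :: "'g \<Rightarrow> 'a set"
    assume *: "multiplier_hopf_star_algebra \<Delta> star \<and> cograding \<Delta> A \<and> (\<forall>p. star ` A p \<subseteq> A p)"
    then have A: "cograding \<Delta> A" and star: "star_algebra star"
      by (simp_all add: multiplier_hopf_star_algebra_def)
    obtain \<pi> where \<pi>: "central_partition \<pi>" "\<And>p. A p = range (lact (\<pi> p))" "\<And>p. \<pi> p \<noteq> 0"
      using cograding_partition[OF A] by metis
    have "lact (finsupp_lift \<pi> f) a = fun_of f p *\<^sub>C a" if "a \<in> A p" for f p a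
      using that finsupp_lift_partition_act[OF \<pi>(1)] by (simp add: \<pi>(2))
    moreover have "finsupp_lift \<pi> (finsupp_cnj f) = multiplier_star star (finsupp_lift \<pi> f)" for f
      using * by (intro finsupp_lift_star[OF \<pi>(1) star]) (simp add: \<pi>(2))
    ultimately show "\<exists>\<gamma> :: 'g finsupp \<Rightarrow> 'a multiplier. nondegenerate_hom \<gamma> \<and> inj \<gamma> \<and>
        range \<gamma> \<subseteq> centre \<and>
        (\<forall>f. multiplier_ext \<Delta> (\<gamma> f) = multiplier_ext (hom_tensor \<gamma> \<gamma>) (comult_K f)) \<and>
        (\<forall>f p. \<forall>a\<in>A p. lact (\<gamma> f) a = fun_of f p *\<^sub>C a) \<and>
        (\<forall>f. \<gamma> (finsupp_cnj f) = multiplier_star star (\<gamma> f))"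
      using forward[OF A \<pi> refl] by blast
  qed
qed

end
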